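(* Let $p,q\ge0$, $p+q\ge1$, and let $\rho$ be an $m$-dimensional representation of $R_{p,q}=C_p\otimes C_q$. Then $$\mathfrak{g}_{p,q}(\rho)\cong\mathfrak{so}(p,q)\oplus\mathfrak{h}_{p,q}(\rho)$$ as Lie algebras, except for the following low-dimensional cases: $p+q=2$ and $\rho$ is pure; $p+q=3$ and $m\in\{2,4\}$; $p+q=4$ and $m\in\{4,8\}$; $p+q=5$ and $m=8$; $p+q=6$ and $m\in\{8,16\}$; $p+q=7$ and $m=16$; $p+q=8$ and $m=16$; $p+q=9$ and $m=16$; $p+q=10$ and $m\in\{16,32\}$; $p+q=11$ and $m=32$.
   Context: $C_r$ denotes the real Clifford algebra of the positive definite quadratic form in $r$ variables (generators $e_i$, $e_i^2=1$, $e_ie_j=-e_je_i$ for $i\ne j$; $C_0=\mathbb{R}$). $R_{p,q}=C_p\otimes_{\mathbb{R}}C_q$ (ungraded tensor product), with $e_1,\dots,e_p$ the generators of $C_p$ and $e_{p+1},\dots,e_{p+q}$ those of $C_q$; $R_{p,q}^+$ is the subalgebra generated by all $e_ie_j$ ($1\le i<j\le p+q$). A (unital) representation $\rho$ of $R_{p,q}$ on $W=\mathbb{R}^m$ is taken so that the basis matrices $S_i=\rho(e_i)$ are symmetric. $\rho$ is called pure if its restriction to $R_{p,q}^+$ is isotypic, i.e. a direct sum of copies of one irreducible representation of $R^+_{p,q}$. Put $\varepsilon_i=1$ for $i\le p$, $\varepsilon_i=-1$ for $i>p$, and $S[w]={}^tw\,S\,w$. The Clifford quartic form is $\tilde P(w)=\sum_i\varepsilon_iS_i[w]^2$.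 $\mathfrak{g}_{p,q}(\rho)$ is the Lie algebra of $G_{p,q}(\rho)=\{g\in GL(W):\tilde P(gw)=\tilde P(w)\}$, i.e. $$\mathfrak{g}_{p,q}(\rho)=\Big\{X\in\mathfrak{gl}(W):\sum_{i=1}^{p+q}\varepsilon_iS_i[w]\,({}^tXS_i+S_iX)[w]=0 \text{ for all } w\in W\Big\},$$ and $\mathfrak{h}_{p,q}(\rho)=\{X\in\mathfrak{gl}(W):{}^tXS_i+S_iX=0\ (1\le i\le p+q)\}$. *)

theory Defs
  imports "HOL-Analysis.Analysis"
begin

section \<open>Real Clifford algebras\<close>

text \<open>
  An element of the Clifford algebra on \<open>r\<close> generators is given by its coordinates in the basis of
  monomials \<open>e\<^sub>A = e\<^sub>a \<cdots> e\<^sub>z\<close>, \<open>A = {a < \<dots> < z} \<subseteq> {1..r}\<close>;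
  all other coordinates vanish.
\<close>

type_synonym cliff = "nat set \<Rightarrow> real"

definition cl_mono :: "nat set \<Rightarrow> cliff" where
  "cl_mono A = (\<lambda>B. if B = A then 1 else 0)"

text \<open>
  Sorting the concatenation of two increasing words costs one sign for each pair that is out of
  order, and \<open>e\<^sub>i\<^sup>2 = 1\<close> then deletes the letters common to both:
  \<open>e\<^sub>A e\<^sub>B = cl_sign A B \<cdot> e\<^sub>C\<close> with \<open>C\<close> the symmetric difference of \<open>A\<close> and \<open>B\<close>.
\<close>

definition cl_sign :: "nat set \<Rightarrow> nat set \<Rightarrow> real" where
  "cl_sign A B = (-1) ^ card {(a, b). a \<in> A \<and> b \<in> B \<and> b < a}"

definition cl_mult :: "nat \<Rightarrow> cliff \<Rightarrow> cliff \<Rightarrow> cliff" where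
  "cl_mult r x y = (\<lambda>C. \<Sum>A\<in>Pow {1..r}. \<Sum>B\<in>Pow {1..r}.
     x A * y B * (cl_sign A B * cl_mono (sym_diff A B) C))"

lemma sum_delta_mono:
  assumes "A \<in> Pow {1..r}"
  shows "(\<Sum>A'\<in>Pow {1..r}. cl_mono A A' * f A') = f A"
proof -
  have "(\<Sum>A'\<in>Pow {1..r}. cl_mono A A' * f A') = (\<Sum>A'\<in>Pow {1..r}. if A' = A then f A' else 0)"
    by (rule sum.cong) (auto simp: cl_mono_def)
  also have "\<dots> = f A" using assms by (simp add: sum.delta)
  finally show ?thesis .
qed

lemma cl_mult_mono:
  assumes "A \<subseteq> {1..r}" "B \<subseteq> {1..r}"
  shows "cl_mult r (cl_mono A) (cl_mono B) = (\<lambda>C. cl_sign A B * cl_mono (sym_diff A B) C)"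
proof
  fix C
  have "cl_mult r (cl_mono A) (cl_mono B) C =
    (\<Sum>A'\<in>Pow {1..r}. cl_mono A A' * (\<Sum>B'\<in>Pow {1..r}. cl_mono B B' *
       (cl_sign A' B' * cl_mono (sym_diff A' B') C)))"
    by (simp add: cl_mult_def sum_distrib_left mult_ac)
  also have "\<dots> = cl_sign A B * cl_mono (sym_diff A B) C"
    using assms by (subst sum_delta_mono, simp)+ simp
  finally show "cl_mult r (cl_mono A) (cl_mono B) C = cl_sign A B * cl_mono (sym_diff A B) C" .
qed

lemma card_sym_diff_parity:
  assumes "finite X" "finite Y"
  shows "(-1::real) ^ card (sym_diff X Y) = (-1) ^ card X * (-1) ^ card Y"
proof -
  have "card X = card (X - Y) + card (X \<inter> Y)" "card Y = card (Y - X) + card (X \<inter> Y)"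
    using card_Int_Diff[of X Y] card_Int_Diff[of Y X] assms by (auto simp: Int_commute)
  moreover have "card (sym_diff X Y) = card (X - Y) + card (Y - X)"
    using assms by (intro card_Un_disjoint) auto
  ultimately show ?thesis
    by (simp add: power_add mult_ac flip: power_mult_distrib)
qed

lemma cl_sign_sym_diff:
  assumes "finite A" "finite B" "finite C"
  shows "cl_sign (sym_diff A B) C = cl_sign A C * cl_sign B C"
    and "cl_sign A (sym_diff B C) = cl_sign A B * cl_sign A C"
proof -
  have fin: "finite {(a, b). a \<in> X \<and> b \<in> Y \<and> b < a}" if "finite X" "finite Y" for X Y :: "nat set"
    by (rule finite_subset[of _ "X \<times> Y"]) (use that in auto)
  have eq: "{(a, b). a \<in> sym_diff A B \<and> b \<in> C \<and> b < a} =
      sym_diff {(a, b). a \<in> A \<and> b \<in> C \<and> b < a} {(a, b). a \<in> B \<and> b \<in> C \<and> b < a}"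
    by auto
  show "cl_sign (sym_diff A B) C = cl_sign A C * cl_sign B C"
    unfolding cl_sign_def eq by (rule card_sym_diff_parity) (simp_all only: fin assms)
  have eq: "{(a, b). a \<in> A \<and> b \<in> sym_diff B C \<and> b < a} =
      sym_diff {(a, b). a \<in> A \<and> b \<in> B \<and> b < a} {(a, b). a \<in> A \<and> b \<in> C \<and> b < a}"
    by auto
  show "cl_sign A (sym_diff B C) = cl_sign A B * cl_sign A C"
    unfolding cl_sign_def eq by (rule card_sym_diff_parity) (simp_all only: fin assms)
qed

lemma cl_sign_assoc:
  assumes "finite A" "finite B" "finite C"
  shows "cl_sign A B * cl_sign (sym_diff A B) C = cl_sign B C * cl_sign A (sym_diff B C)"
  using assms by (simp add: cl_sign_sym_diff)

lemma cl_sign_simps: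
  "cl_sign {} B = 1" "cl_sign A {} = 1" "cl_sign {i} {j} = (if j < i then -1 else 1)"
proof -
  have "{(a, b). a = i \<and> b = j \<and> b < a} = (if j < i then {(i, j)} else {})" by auto
  then show "cl_sign {i} {j} = (if j < i then -1 else 1)" by (simp add: cl_sign_def)
qed (simp_all add: cl_sign_def)

section \<open>The ungraded tensor product of two Clifford algebras\<close>

type_synonym cliff2 = "nat set \<times> nat set \<Rightarrow> real"

abbreviation R_index :: "nat \<Rightarrow> nat \<Rightarrow> (nat set \<times> nat set) set" where
  "R_index p q \<equiv> Pow {1..p} \<times> Pow {1..q}"

definition R_carrier :: "nat \<Rightarrow> nat \<Rightarrow> cliff2 set" where
  "R_carrier p q = {x. \<forall>I. I \<notin> R_index p q \<longrightarrow> x I = 0}"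

definition tensor :: "cliff \<Rightarrow> cliff \<Rightarrow> cliff2" where
  "tensor x y = (\<lambda>(A, B). x A * y B)"

definition R_add :: "cliff2 \<Rightarrow> cliff2 \<Rightarrow> cliff2" where
  "R_add x y = (\<lambda>I. x I + y I)"

definition R_scale :: "real \<Rightarrow> cliff2 \<Rightarrow> cliff2" where
  "R_scale c x = (\<lambda>I. c * x I)"

text \<open>The bilinear extension of \<open>(a \<otimes> b) (a' \<otimes> b') = a a' \<otimes> b b'\<close>.\<close>

definition R_mult :: "nat \<Rightarrow> nat \<Rightarrow> cliff2 \<Rightarrow> cliff2 \<Rightarrow> cliff2" where
  "R_mult p q x y = (\<lambda>I. \<Sum>(A, B)\<in>R_index p q. \<Sum>(A', B')\<in>R_index p q.
     x (A, B) * y (A', B') *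
     tensor (cl_mult p (cl_mono A) (cl_mono A')) (cl_mult q (cl_mono B) (cl_mono B')) I)"

definition R_one :: cliff2 where
  "R_one = tensor (cl_mono {}) (cl_mono {})"

definition R_gen :: "nat \<Rightarrow> nat \<Rightarrow> cliff2" where
  "R_gen p i = (if i \<le> p then tensor (cl_mono {i}) (cl_mono {})
                else tensor (cl_mono {}) (cl_mono {i - p}))"

lemma tensor_mono: "tensor (cl_mono A) (cl_mono B) = (\<lambda>I. if I = (A, B) then 1 else 0)"
  by (auto simp: tensor_def cl_mono_def fun_eq_iff)

lemma R_mult_mono:
  assumes "A \<subseteq> {1..p}" "A' \<subseteq> {1..p}" "B \<subseteq> {1..q}" "B' \<subseteq> {1..q}"
  shows "R_mult p q (tensor (cl_mono A) (cl_mono B)) (tensor (cl_mono A') (cl_mono B')) =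
    R_scale (cl_sign A A' * cl_sign B B') (tensor (cl_mono (sym_diff A A')) (cl_mono (sym_diff B B')))"
proof
  fix I
  let ?T = "\<lambda>J K. tensor (cl_mult p (cl_mono (fst J)) (cl_mono (fst K)))
                          (cl_mult q (cl_mono (snd J)) (cl_mono (snd K))) I"
  have "R_mult p q (tensor (cl_mono A) (cl_mono B)) (tensor (cl_mono A') (cl_mono B')) I
     = (\<Sum>J\<in>R_index p q. \<Sum>K\<in>R_index p q. if J = (A, B) then if K = (A', B') then ?T J K else 0 else 0)"
    unfolding R_mult_def tensor_mono by (intro sum.cong refl) (auto intro!: sum.cong)
  also have "\<dots> = (\<Sum>J\<in>R_index p q. if J = (A, B) then \<Sum>K\<in>R_index p q. if K = (A', B') then ?T J K else 0 else 0)"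
    by (intro sum.cong refl) auto
  also have "\<dots> = ?T (A, B) (A', B')"
    using assms by (simp add: sum.delta)
  finally show "R_mult p q (tensor (cl_mono A) (cl_mono B)) (tensor (cl_mono A') (cl_mono B')) I =
    R_scale (cl_sign A A' * cl_sign B B') (tensor (cl_mono (sym_diff A A')) (cl_mono (sym_diff B B'))) I"
    using assms by (simp add: cl_mult_mono R_scale_def tensor_def split: prod.splits)
qed

lemma R_gen_square:
  assumes "i \<in> {1..p+q}"
  shows "R_mult p q (R_gen p i) (R_gen p i) = R_one"
proof (cases "i \<le> p")
  case True
  then show ?thesis
    using assms by (simp add: R_gen_def R_mult_mono cl_sign_simps R_one_def R_scale_def)
next
  case False
  then have "{i - p} \<subseteq> {1..q}" using assms by auto
  from R_mult_mono[OF empty_subsetI empty_subsetI this this] show ?thesis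
    using False by (simp add: R_gen_def cl_sign_simps R_one_def R_scale_def)
qed

lemma R_gen_anticommute:
  assumes "i \<in> {1..p+q}" "j \<in> {1..p+q}" "i \<noteq> j" "i \<le> p \<longleftrightarrow> j \<le> p"
  shows "R_mult p q (R_gen p i) (R_gen p j) = R_scale (-1) (R_mult p q (R_gen p j) (R_gen p i))"
proof (cases "i \<le> p")
  case True
  then show ?thesis
    using assms by (auto simp: R_gen_def R_mult_mono cl_sign_simps R_scale_def Un_commute)
next
  case False
  then have sub: "{i - p} \<subseteq> {1..q}" "{j - p} \<subseteq> {1..q}" using assms by auto
  have sign: "cl_sign {i - p} {j - p} = - cl_sign {j - p} {i - p}"
    using False assms unfolding cl_sign_simps by auto
  have sym: "sym_diff {i - p} {j - p} = sym_diff {j - p} {i - p}" by blast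
  have gen: "R_gen p i = tensor (cl_mono {}) (cl_mono {i - p})"
    "R_gen p j = tensor (cl_mono {}) (cl_mono {j - p})"
    using False assms(4) by (auto simp: R_gen_def)
  show ?thesis
    unfolding gen R_mult_mono[OF empty_subsetI empty_subsetI sub]
      R_mult_mono[OF empty_subsetI empty_subsetI sub(2,1)]
    by (subst sign, subst sym) (simp add: R_scale_def)
qed

lemma R_gen_commute:
  assumes "i \<in> {1..p}" "j \<in> {p+1..p+q}"
  shows "R_mult p q (R_gen p i) (R_gen p j) = R_mult p q (R_gen p j) (R_gen p i)"
proof -
  have i: "{i} \<subseteq> {1..p}" and j: "{j - p} \<subseteq> {1..q}" using assms by auto
  show ?thesis
    using assms R_mult_mono[OF i empty_subsetI empty_subsetI j]
      R_mult_mono[OF empty_subsetI i j empty_subsetI]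
    by (simp add: R_gen_def cl_sign_simps R_scale_def)
qed

text \<open>Subalgebras are unital; this matters only for \<open>p + q = 1\<close>, where there is no \<open>e\<^sub>i e\<^sub>j\<close>.\<close>

inductive_set R_plus :: "nat \<Rightarrow> nat \<Rightarrow> cliff2 set" for p q :: nat where
  one: "R_one \<in> R_plus p q"
| gen: "\<lbrakk>1 \<le> i; i < j; j \<le> p + q\<rbrakk> \<Longrightarrow> R_mult p q (R_gen p i) (R_gen p j) \<in> R_plus p q"
| add: "\<lbrakk>x \<in> R_plus p q; y \<in> R_plus p q\<rbrakk> \<Longrightarrow> R_add x y \<in> R_plus p q"
| scale: "x \<in> R_plus p q \<Longrightarrow> R_scale c x \<in> R_plus p q"
| mult: "\<lbrakk>x \<in> R_plus p q; y \<in> R_plus p q\<rbrakk> \<Longrightarrow> R_mult p q x y \<in> R_plus p q"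

lemma R_mult_closed: "R_mult p q x y \<in> R_carrier p q"
proof -
  have "cl_mult r (cl_mono A) (cl_mono A') C = 0"
    if "A \<subseteq> {1..r}" "A' \<subseteq> {1..r}" "C \<notin> Pow {1..r}" for r A A' C
  proof -
    have "C \<noteq> sym_diff A A'" using that by auto
    then show ?thesis by (subst cl_mult_mono[OF that(1,2)]) (simp add: cl_mono_def)
  qed
  note zero = this
  have "R_mult p q x y (C, D) = 0" if "C \<notin> Pow {1..p} \<or> D \<notin> Pow {1..q}" for C D
  proof -
    have "tensor (cl_mult p (cl_mono A) (cl_mono A')) (cl_mult q (cl_mono B) (cl_mono B')) (C, D) = 0"
      if "A \<in> Pow {1..p}" "B \<in> Pow {1..q}" "A' \<in> Pow {1..p}" "B' \<in> Pow {1..q}" for A A' B B'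
      using that \<open>C \<notin> Pow {1..p} \<or> D \<notin> Pow {1..q}\<close> zero[of A p A' C] zero[of B q B' D]
      unfolding tensor_def by (elim disjE) simp_all
    then show ?thesis
      unfolding R_mult_def by (intro sum.neutral ballI, clarify) (intro sum.neutral ballI, clarify, simp)
  qed
  note outside = this
  show ?thesis
    unfolding R_carrier_def
  proof (intro CollectI allI impI)
    fix I assume "I \<notin> R_index p q"
    then have "fst I \<notin> Pow {1..p} \<or> snd I \<notin> Pow {1..q}"
      unfolding mem_Times_iff de_Morgan_conj .
    from outside[OF this] show "R_mult p q x y I = 0"
      unfolding prod.collapse .
  qed
qed

lemma tensor_mono_carrier:
  assumes "A \<subseteq> {1..p}" "B \<subseteq> {1..q}"
  shows "tensor (cl_mono A) (cl_mono B) \<in> R_carrier p q"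
  using assms unfolding R_carrier_def tensor_mono by auto

lemma R_gen_carrier:
  assumes "i \<in> {1..p+q}"
  shows "R_gen p i \<in> R_carrier p q"
proof (cases "i \<le> p")
  case True
  then have "{i} \<subseteq> {1..p}" using assms by auto
  from tensor_mono_carrier[OF this empty_subsetI] show ?thesis
    using True by (simp only: R_gen_def if_True)
next
  case False
  then have "{i - p} \<subseteq> {1..q}" using assms by auto
  from tensor_mono_carrier[OF empty_subsetI this] show ?thesis
    using False by (simp only: R_gen_def if_False)
qed

lemma R_plus_carrier: "x \<in> R_plus p q \<Longrightarrow> x \<in> R_carrier p q"
proof (induction rule: R_plus.induct)
  case one
  show ?case unfolding R_one_def by (rule tensor_mono_carrier) auto
next
  case (add x y)
  then show ?case by (simp add: R_carrier_def R_add_def)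
next
  case (scale x c)
  then show ?case by (simp add: R_carrier_def R_scale_def)
next
  case (gen i j)
  show ?case by (rule R_mult_closed)
next
  case (mult x y)
  show ?case by (rule R_mult_closed)
qed

section \<open>Representations\<close>

definition R_representation :: "nat \<Rightarrow> nat \<Rightarrow> (cliff2 \<Rightarrow> real^'m^'m) \<Rightarrow> bool" where
  "R_representation p q \<rho> \<longleftrightarrow>
     \<rho> R_one = mat 1 \<and>
     (\<forall>x\<in>R_carrier p q. \<forall>y\<in>R_carrier p q.
        \<rho> (R_add x y) = \<rho> x + \<rho> y \<and> \<rho> (R_mult p q x y) = \<rho> x ** \<rho> y) \<and>
     (\<forall>c. \<forall>x\<in>R_carrier p q. \<rho> (R_scale c x) = c *\<^sub>R \<rho> x)"

definition symmetric_basis :: "nat \<Rightarrow> nat \<Rightarrow> (cliff2 \<Rightarrow> real^'m^'m) \<Rightarrow> bool" where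
  "symmetric_basis p q \<rho> \<longleftrightarrow>
     (\<forall>i\<in>{1..p+q}. transpose (\<rho> (R_gen p i)) = \<rho> (R_gen p i))"

definition plus_subrep ::
  "nat \<Rightarrow> nat \<Rightarrow> (cliff2 \<Rightarrow> real^'m^'m) \<Rightarrow> (real^'m) set \<Rightarrow> bool" where
  "plus_subrep p q \<rho> U \<longleftrightarrow> subspace U \<and> (\<forall>a\<in>R_plus p q. \<forall>u\<in>U. \<rho> a *v u \<in> U)"

definition plus_irreducible ::
  "nat \<Rightarrow> nat \<Rightarrow> (cliff2 \<Rightarrow> real^'m^'m) \<Rightarrow> (real^'m) set \<Rightarrow> bool" where
  "plus_irreducible p q \<rho> U \<longleftrightarrow>
     plus_subrep p q \<rho> U \<and> U \<noteq> {0} \<and>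
     (\<forall>V. plus_subrep p q \<rho> V \<and> V \<subseteq> U \<longrightarrow> V = {0} \<or> V = U)"

definition plus_equivalent ::
  "nat \<Rightarrow> nat \<Rightarrow> (cliff2 \<Rightarrow> real^'m^'m) \<Rightarrow> (real^'m) set \<Rightarrow> (real^'m) set \<Rightarrow> bool" where
  "plus_equivalent p q \<rho> U V \<longleftrightarrow>
     (\<exists>f. linear f \<and> bij_betw f U V \<and> (\<forall>a\<in>R_plus p q. \<forall>u\<in>U. f (\<rho> a *v u) = \<rho> a *v f u))"

definition internal_direct_sum :: "nat \<Rightarrow> (nat \<Rightarrow> (real^'m) set) \<Rightarrow> bool" where
  "internal_direct_sum k U \<longleftrightarrow>
     (\<forall>w. \<exists>u. (\<forall>i<k. u i \<in> U i) \<and> w = (\<Sum>i<k. u i)) \<and>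
     (\<forall>u. (\<forall>i<k. u i \<in> U i) \<and> (\<Sum>i<k. u i) = 0 \<longrightarrow> (\<forall>i<k. u i = 0))"

text \<open>
  The representation space is nonzero, so the irreducible representation whose copies make it up
  can be taken inside it. A linear isomorphism between subspaces extends to the whole space.
\<close>

definition pure :: "nat \<Rightarrow> nat \<Rightarrow> (cliff2 \<Rightarrow> real^'m^'m) \<Rightarrow> bool" where
  "pure p q \<rho> \<longleftrightarrow>
     (\<exists>V k U. plus_irreducible p q \<rho> V \<and> internal_direct_sum k U \<and>
        (\<forall>i<k. plus_subrep p q \<rho> (U i) \<and> plus_equivalent p q \<rho> V (U i)))"

section \<open>Lie algebras\<close>

record 'a lie_algebra =
  lie_carrier :: "'a set"
  lie_add :: "'a \<Rightarrow> 'a \<Rightarrow> 'a"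
  lie_scale :: "real \<Rightarrow> 'a \<Rightarrow> 'a"
  lie_bracket :: "'a \<Rightarrow> 'a \<Rightarrow> 'a"

definition lie_direct_sum :: "'a lie_algebra \<Rightarrow> 'b lie_algebra \<Rightarrow> ('a \<times> 'b) lie_algebra" where
  "lie_direct_sum L M =
     \<lparr>lie_carrier = lie_carrier L \<times> lie_carrier M,
      lie_add = (\<lambda>(x, y) (x', y'). (lie_add L x x', lie_add M y y')),
      lie_scale = (\<lambda>c (x, y). (lie_scale L c x, lie_scale M c y)),
      lie_bracket = (\<lambda>(x, y) (x', y'). (lie_bracket L x x', lie_bracket M y y'))\<rparr>"

definition lie_isomorphic :: "'a lie_algebra \<Rightarrow> 'b lie_algebra \<Rightarrow> bool" where
  "lie_isomorphic L M \<longleftrightarrow>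
     (\<exists>f. bij_betw f (lie_carrier L) (lie_carrier M) \<and>
        (\<forall>x\<in>lie_carrier L. \<forall>y\<in>lie_carrier L.
           f (lie_add L x y) = lie_add M (f x) (f y) \<and>
           f (lie_bracket L x y) = lie_bracket M (f x) (f y)) \<and>
        (\<forall>c. \<forall>x\<in>lie_carrier L. f (lie_scale L c x) = lie_scale M c (f x)))"

definition matrix_lie :: "(real^'m^'m) set \<Rightarrow> (real^'m^'m) lie_algebra" where
  "matrix_lie S =
     \<lparr>lie_carrier = S, lie_add = (+), lie_scale = (*\<^sub>R),
      lie_bracket = (\<lambda>X Y. X ** Y - Y ** X)\<rparr>"

definition sgn_pq :: "nat \<Rightarrow> nat \<Rightarrow> real" where
  "sgn_pq p i = (if i \<le> p then 1 else -1)"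

text \<open>
  \<open>\<ss>\<oo>(p,q)\<close>: matrices \<open>A\<close> with \<open>\<^sup>tA I + I A = 0\<close> for \<open>I = diag (sgn_pq p)\<close>. As \<open>p + q\<close> is not
  a type, they are functions of two indices that vanish outside \<open>{1..p+q}\<close>.
\<close>

definition so_lie :: "nat \<Rightarrow> nat \<Rightarrow> (nat \<Rightarrow> nat \<Rightarrow> real) lie_algebra" where
  "so_lie p q =
     \<lparr>lie_carrier = {A. (\<forall>i j. i \<notin> {1..p+q} \<or> j \<notin> {1..p+q} \<longrightarrow> A i j = 0) \<and>
                        (\<forall>i\<in>{1..p+q}. \<forall>j\<in>{1..p+q}. A j i * sgn_pq p j + sgn_pq p i * A i j = 0)},
      lie_add = (\<lambda>A B i j. A i j + B i j),
      lie_scale = (\<lambda>c A i j. c * A i j),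
      lie_bracket = (\<lambda>A B i j. (\<Sum>k\<in>{1..p+q}. A i k * B k j) - (\<Sum>k\<in>{1..p+q}. B i k * A k j))\<rparr>"

section \<open>Lie algebras attached to the Clifford quartic form\<close>

definition qform :: "real^'m^'m \<Rightarrow> real^'m \<Rightarrow> real" where
  "qform S w = w \<bullet> (S *v w)"

lemma qform_derivative:
  "((\<lambda>t. qform S (w + t *\<^sub>R (X *v w))) has_real_derivative qform (transpose X ** S + S ** X) w) (at 0)"
proof -
  have "qform S (w + t *\<^sub>R (X *v w)) =
      qform S w + t * qform (transpose X ** S + S ** X) w + t\<^sup>2 * qform S (X *v w)" for t
    by (simp add: qform_def matrix_vector_mult_add_rdistrib matrix_vector_right_distrib
        matrix_vector_mult_scaleR inner_add_left inner_add_right power2_eq_square algebra_simps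
        dot_lmul_matrix vector_transpose_matrix flip: matrix_vector_mul_assoc)
      (metis dot_lmul_matrix transpose_matrix_vector transpose_transpose inner_commute)
  then show ?thesis
    by (auto intro!: derivative_eq_intros)
qed

definition clifford_quartic :: "nat \<Rightarrow> nat \<Rightarrow> (cliff2 \<Rightarrow> real^'m^'m) \<Rightarrow> real^'m \<Rightarrow> real" where
  "clifford_quartic p q \<rho> w = (\<Sum>i=1..p+q. sgn_pq p i * (qform (\<rho> (R_gen p i)) w)\<^sup>2)"

lemma clifford_quartic_derivative:
  "((\<lambda>t. clifford_quartic p q \<rho> (w + t *\<^sub>R (X *v w))) has_real_derivative
     2 * (\<Sum>i=1..p+q. let S = \<rho> (R_gen p i) in
        sgn_pq p i * qform S w * qform (transpose X ** S + S ** X) w)) (at 0)"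
  unfolding clifford_quartic_def Let_def sum_distrib_left
  by (rule DERIV_sum) (auto intro!: derivative_eq_intros qform_derivative)

definition g_lie :: "nat \<Rightarrow> nat \<Rightarrow> (cliff2 \<Rightarrow> real^'m^'m) \<Rightarrow> (real^'m^'m) lie_algebra" where
  "g_lie p q \<rho> = matrix_lie {X. \<forall>w.
     (\<Sum>i=1..p+q. let S = \<rho> (R_gen p i) in
        sgn_pq p i * qform S w * qform (transpose X ** S + S ** X) w) = 0}"

definition h_lie :: "nat \<Rightarrow> nat \<Rightarrow> (cliff2 \<Rightarrow> real^'m^'m) \<Rightarrow> (real^'m^'m) lie_algebra" where
  "h_lie p q \<rho> = matrix_lie {X. \<forall>i\<in>{1..p+q}. let S = \<rho> (R_gen p i) in
     transpose X ** S + S ** X = 0}"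

end

theory Submission
  imports Defs
begin

text \<open>
  Write \<open>Y\<^sub>k = \<^sup>tX S\<^sub>k + S\<^sub>k X\<close>. If \<open>X\<close> lies in the Lie algebra \<open>\<gg>\<close>, then
  polarising \<open>\<Sum> \<epsilon>\<^sub>i S\<^sub>i[w] Y\<^sub>i[w] = 0\<close> and contracting two of the four arguments with \<open>S\<^sub>k\<close> gives
  \<open>(m + 8) Y\<^sub>k = 2 (S\<^sub>k T + \<^sup>tT S\<^sub>k) + L\<^sub>k\<close> with \<open>T = \<Sum> S\<^sub>i Y\<^sub>i\<close> and \<open>L\<^sub>k\<close> in the span of the
  \<open>S\<^sub>i\<close>. The maps \<open>X \<mapsto> S\<^sub>i \<^sup>tX S\<^sub>i\<close> are commuting isometric involutions, and in terms of
  \<open>N X = \<Sum> (X + S\<^sub>i \<^sup>tX S\<^sub>i) / 2\<close> the relation reads \<open>(m + 8 - 4 N) (S\<^sub>k Y\<^sub>k) = S\<^sub>k L\<^sub>k\<close>.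
  Since \<open>N \<le> n = p + q\<close>, the operator on the left is invertible as soon as \<open>m + 8 > 4 n\<close>; it
  maps the span of each \<open>S\<^sub>k S\<^sub>i\<close> to itself, so \<open>Y\<^sub>k = \<Sum> A\<^sub>k\<^sub>i S\<^sub>i\<close>, and traces show that
  \<open>A\<close> lies in \<open>\<ss>\<oo>(p,q)\<close>. The \<open>S\<^sub>k S\<^sub>i\<close> span a complement of \<open>\<hh>\<close> that commutes with it.

  For \<open>n \<ge> 3\<close> the excluded cases are exactly those in which \<open>m + 8 > 4 n\<close> can fail: this follows
  from divisibility of \<open>m\<close> by powers of 2 (commuting involutions and quaternion units inside the
  algebra) and, for \<open>n \<ge> 11\<close>, from counting orthogonal monomials in \<open>m \<times> m\<close> matrices. For
  \<open>n = 2\<close> a non-pure \<open>\<rho>\<close> has \<open>p = q = 1\<close>, and \<open>S\<^sub>1 \<plusminus> S\<^sub>2\<close> have complementary supports.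
\<close>

section \<open>Matrix algebra\<close>

lemma mat_minus_left: "(- A) ** B = - (A ** (B::real^'m^'m))"
  by (simp add: matrix_matrix_mult_def vec_eq_iff sum_negf)

lemma mat_minus_right: "A ** (- B) = - (A ** (B::real^'m^'m))"
  by (simp add: matrix_matrix_mult_def vec_eq_iff sum_negf)

lemma mat_add_rdistrib: "(A + B) ** C = A ** C + B ** (C::real^'m^'m)"
  by (simp add: matrix_matrix_mult_def vec_eq_iff sum.distrib algebra_simps)

lemma mat_diff_ldistrib: "A ** (B - C) = A ** B - A ** (C::real^'m^'m)"
  by (simp add: matrix_matrix_mult_def vec_eq_iff sum_subtractf algebra_simps)

lemma mat_diff_rdistrib: "(A - B) ** C = A ** C - B ** (C::real^'m^'m)"
  by (simp add: matrix_matrix_mult_def vec_eq_iff sum_subtractf algebra_simps)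

lemma mat_scaleR_left: "(c *\<^sub>R A) ** B = c *\<^sub>R (A ** (B::real^'m^'m))"
  by (simp add: matrix_matrix_mult_def vec_eq_iff sum_distrib_left mult.assoc)

lemma mat_scaleR_right: "A ** (c *\<^sub>R B) = c *\<^sub>R (A ** (B::real^'m^'m))"
  by (simp add: matrix_matrix_mult_def vec_eq_iff sum_distrib_left algebra_simps)

lemma mat_zero_left: "0 ** (B::real^'m^'m) = 0"
  by (simp add: matrix_matrix_mult_def vec_eq_iff)

lemma mat_zero_right: "(B::real^'m^'m) ** 0 = 0"
  by (simp add: matrix_matrix_mult_def vec_eq_iff)

lemma mat_sum_left: "(\<Sum>i\<in>I. f i) ** B = (\<Sum>i\<in>I. f i ** (B::real^'m^'m))"
  by (induction I rule: infinite_finite_induct) (simp_all add: mat_zero_left mat_add_rdistrib)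

lemma mat_sum_right: "B ** (\<Sum>i\<in>I. f i) = (\<Sum>i\<in>I. B ** (f i :: real^'m^'m))"
  by (induction I rule: infinite_finite_induct) (simp_all add: mat_zero_right matrix_add_ldistrib)

lemma transpose_add: "transpose (A + B) = transpose A + transpose (B::real^'m^'m)"
  by (simp add: transpose_def vec_eq_iff)

lemma transpose_diff: "transpose (A - B) = transpose A - transpose (B::real^'m^'m)"
  by (simp add: transpose_def vec_eq_iff)

lemma transpose_minus: "transpose (- A) = - transpose (A::real^'m^'m)"
  by (simp add: transpose_def vec_eq_iff)

lemma transpose_zero: "transpose (0::real^'m^'m) = 0"
  by (simp add: transpose_def vec_eq_iff)

lemma transpose_sum: "transpose (\<Sum>i\<in>I. f i) = (\<Sum>i\<in>I. transpose (f i :: real^'m^'m))"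
  by (induction I rule: infinite_finite_induct) (simp_all add: transpose_zero transpose_add)

lemma trace_scaleR: "trace (c *\<^sub>R A) = c * trace (A::real^'m^'m)"
  by (simp add: trace_def sum_distrib_left)

lemma trace_minus: "trace (- A) = - trace (A::real^'m^'m)"
  by (simp add: trace_def sum_negf)

lemma trace_zero: "trace (0::real^'m^'m) = 0"
  by (simp add: trace_def)

lemma trace_sum: "trace (\<Sum>i\<in>I. f i) = (\<Sum>i\<in>I. trace (f i :: real^'m^'m))"
  by (induction I rule: infinite_finite_induct) (simp_all add: trace_zero trace_add)

lemma trace_transpose: "trace (transpose A) = trace (A::real^'m^'m)"
  by (simp add: trace_def transpose_def)

lemma numeral_times_mat: "numeral w * A = numeral w *\<^sub>R (A :: real^'m^'m)"
  by (simp add: scaleR_conv_of_real)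

lemmas mat_alg = matrix_add_ldistrib mat_add_rdistrib mat_diff_ldistrib mat_diff_rdistrib
  mat_minus_left mat_minus_right mat_scaleR_left mat_scaleR_right mat_zero_left mat_zero_right
  mat_sum_left mat_sum_right

lemmas transpose_alg = transpose_add transpose_diff transpose_minus transpose_zero transpose_scalar
  transpose_sum matrix_transpose_mul

lemmas trace_alg = trace_add trace_sub trace_minus trace_zero trace_scaleR trace_sum

lemma mat_eq_iff_mult: "A = B \<longleftrightarrow> (\<forall>x. A *v x = B *v (x::real^'m))"
  for A B :: "real^'m^'m"
  by (metis matrix_of_matrix_vector_mul ext)

lemma matrix_vector_mult_minus_left: "(- A) *v x = - (A *v (x::real^'m))"
  for A :: "real^'m^'m"
  using matrix_vector_mult_diff_rdistrib[of 0 A x] by simp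

lemma matrix_vector_mult_minus_right: "A *v (- x) = - (A *v (x::real^'m))"
  for A :: "real^'m^'m"
  using matrix_vector_mult_diff_distrib[of A 0 x] by simp

lemma matrix_vector_mult_scaleR_left: "(c *\<^sub>R A) *v x = c *\<^sub>R (A *v (x::real^'m))"
  for A :: "real^'m^'m"
  by (simp add: scaleR_matrix_vector_assoc)

lemma matrix_vector_mult_sum_left: "(\<Sum>i\<in>I. f i) *v x = (\<Sum>i\<in>I. f i *v (x::real^'m))"
  for f :: "'i \<Rightarrow> real^'m^'m"
  by (induction I rule: infinite_finite_induct) (simp_all add: matrix_vector_mult_add_rdistrib)

lemma inner_mult_transpose: "(A *v x) \<bullet> y = x \<bullet> (transpose A *v (y::real^'m))"
  for A :: "real^'m^'m"
  by (metis dot_lmul_matrix inner_commute transpose_matrix_vector vector_transpose_matrix)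

lemma inner_symmetric_mat: "transpose A = A \<Longrightarrow> (A *v x) \<bullet> y = x \<bullet> (A *v (y::real^'m))"
  for A :: "real^'m^'m"
  by (simp add: inner_mult_transpose del: transpose_matrix_vector)

text \<open>Identifies the inner product of matrices with the Frobenius product, so that vanishing
  traces mean orthogonality and Cauchy-Schwarz applies to matrices.\<close>

lemma inner_mat: "A \<bullet> B = trace (transpose A ** (B::real^'m^'m))"
  by (subst trace_mul_sym)
    (simp add: inner_vec_def trace_def matrix_matrix_mult_def transpose_def mult.commute)

lemma trace_sum_axis: "trace A = (\<Sum>j\<in>UNIV. axis j 1 \<bullet> (A *v axis j 1))"
  for A :: "real^'m^'m"
  by (simp add: trace_def inner_axis' matrix_vector_mult_basis column_def)

section \<open>Quadratic forms\<close>

lemma qform_scaleR: "qform (c *\<^sub>R A) w = c * qform A w"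
  by (simp add: qform_def matrix_vector_mult_scaleR_left)

lemma qform_add: "qform (A + B) w = qform A w + qform B w"
  by (simp add: qform_def matrix_vector_mult_add_rdistrib inner_add_right)

lemma qform_diff: "qform (A - B) w = qform A w - qform B w"
  by (simp add: qform_def matrix_vector_mult_diff_rdistrib inner_diff_right)

lemma qform_sum: "qform (\<Sum>i\<in>I. f i) w = (\<Sum>i\<in>I. qform (f i) w)"
  by (simp add: qform_def matrix_vector_mult_sum_left inner_sum_right)

lemma qform_vec_add:
  assumes "transpose A = A"
  shows "qform A (x + y) = qform A x + qform A y + 2 * (x \<bullet> (A *v y))"
  using inner_symmetric_mat[OF assms, of x y]
  by (simp add: qform_def matrix_vector_right_distrib inner_add_left inner_add_right inner_commute)

lemma qform_vec_diff:
  assumes "transpose A = A"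
  shows "qform A (x - y) = qform A x + qform A y - 2 * (x \<bullet> (A *v y))"
  using inner_symmetric_mat[OF assms, of x y]
  by (simp add: qform_def matrix_vector_mult_diff_distrib inner_diff_left inner_diff_right inner_commute)

lemma qform_eq_0_imp:
  assumes "transpose A = A" "\<And>w. qform A w = 0"
  shows "A = 0"
proof -
  have "x \<bullet> (A *v y) = 0" for x y
    using qform_vec_add[OF assms(1), of x y] by (simp add: assms(2))
  then have "A *v y = 0" for y
    by (metis inner_eq_zero_iff)
  then show ?thesis
    by (simp add: mat_eq_iff_mult)
qed

text \<open>
  The proof extracts the \<open>t\<^sup>2\<close>-coefficient of the quartic at \<open>w + t x\<close>, a quadratic form in
  \<open>x\<close>, and contracts its polarisation with \<open>B\<close>.
\<close>

lemma quartic_contraction: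
  fixes S Y :: "'i \<Rightarrow> real^'m^'m" and B :: "real^'m^'m"
  assumes S: "\<And>i. i \<in> I \<Longrightarrow> transpose (S i) = S i"
    and Y: "\<And>i. i \<in> I \<Longrightarrow> transpose (Y i) = Y i"
    and B: "transpose B = B"
    and zero: "\<And>w. (\<Sum>i\<in>I. qform (S i) w * qform (Y i) w) = 0"
  shows "(\<Sum>i\<in>I. trace (Y i ** B) *\<^sub>R S i + trace (S i ** B) *\<^sub>R Y i +
           2 *\<^sub>R (S i ** B ** Y i + Y i ** B ** S i)) = 0" (is "(\<Sum>i\<in>I. ?M i) = 0")
proof (rule qform_eq_0_imp)
  have "transpose (?M i) = ?M i" if "i \<in> I" for i
    using S[OF that] Y[OF that] B by (simp add: transpose_alg matrix_mul_assoc add_ac)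
  then show "transpose (\<Sum>i\<in>I. ?M i) = (\<Sum>i\<in>I. ?M i)"
    by (simp add: transpose_sum)
  fix w
  \<comment> \<open>\<open>c x\<close> is the part of the quartic at \<open>w + x\<close> that is
    quadratic in \<open>x\<close>.\<close>
  define c where "c x = (\<Sum>i\<in>I. qform (S i) w * qform (Y i) x + qform (S i) x * qform (Y i) w
      + 4 * ((w \<bullet> (S i *v x)) * (w \<bullet> (Y i *v x))))" for x
  have c0: "c x = 0" for x
  proof -
    \<comment> \<open>Adding the values at \<open>w + x\<close> and \<open>w - x\<close> cancels the
      terms odd in \<open>x\<close>.\<close>
    have "2 * c x = (\<Sum>i\<in>I. qform (S i) (w + x) * qform (Y i) (w + x)) +
        (\<Sum>i\<in>I. qform (S i) (w - x) * qform (Y i) (w - x))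
        - 2 * (\<Sum>i\<in>I. qform (S i) w * qform (Y i) w) - 2 * (\<Sum>i\<in>I. qform (S i) x * qform (Y i) x)"
      unfolding c_def sum_distrib_left sum.distrib[symmetric] sum_subtractf[symmetric]
      by (intro sum.cong refl) (simp add: S Y qform_vec_add qform_vec_diff algebra_simps)
    then show ?thesis by (simp add: zero)
  qed
  \<comment> \<open>The symmetric bilinear form belonging to the quadratic form
    \<open>c\<close>.\<close>
  define d where "d x y = (\<Sum>i\<in>I. qform (S i) w * (x \<bullet> (Y i *v y)) + (x \<bullet> (S i *v y)) * qform (Y i) w
      + 2 * (((S i *v w) \<bullet> x) * ((Y i *v w) \<bullet> y)) + 2 * (((S i *v w) \<bullet> y) * ((Y i *v w) \<bullet> x)))" for x y
  have d0: "d x y = 0" for x y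
  proof -
    have "2 * d x y = c (x + y) - c x - c y"
      unfolding c_def d_def sum_distrib_left sum_subtractf[symmetric]
      by (intro sum.cong refl) (simp add: S Y qform_vec_add inner_symmetric_mat[symmetric]
          inner_add_right algebra_simps)
    then show ?thesis by (simp add: c0)
  qed
  let ?e = "\<lambda>j. axis j 1 :: real^'m"
  have tr: "(\<Sum>j\<in>UNIV. ?e j \<bullet> (A *v (B *v ?e j))) = trace (A ** B)" for A
    by (simp add: trace_sum_axis matrix_vector_mul_assoc)
  \<comment> \<open>Parseval for the standard basis, after moving \<open>B\<close> to the other
    factor.\<close>
  have par: "(\<Sum>j\<in>UNIV. (u \<bullet> ?e j) * (v \<bullet> (B *v ?e j))) = u \<bullet> (B *v v)" for u v
    unfolding inner_symmetric_mat[OF B, symmetric, of v]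
    by (simp add: inner_axis) (simp add: inner_vec_def)
  \<comment> \<open>Contraction with \<open>B\<close>: a basis vector and its image under
    \<open>B\<close> are inserted, and the result is summed over the basis.\<close>
  have "0 = (\<Sum>j\<in>UNIV. d (?e j) (B *v ?e j))"
    by (simp add: d0)
  also have "\<dots> = (\<Sum>i\<in>I. qform (S i) w * trace (Y i ** B) + trace (S i ** B) * qform (Y i) w
      + 2 * ((S i *v w) \<bullet> (B *v (Y i *v w))) + 2 * ((Y i *v w) \<bullet> (B *v (S i *v w))))"
    unfolding d_def
    by (subst sum.swap) (simp add: sum.distrib tr par mult.commute[of "_ \<bullet> (B *v _)"] flip: sum_distrib_left sum_distrib_right)
  also have "\<dots> = (\<Sum>i\<in>I. qform (?M i) w)"
    by (intro sum.cong refl)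
      (simp add: S Y qform_add qform_scaleR qform_def[of "_ ** _"] inner_symmetric_mat matrix_vector_mul_assoc matrix_mul_assoc algebra_simps)
  finally show "qform (\<Sum>i\<in>I. ?M i) w = 0"
    by (simp add: qform_sum)
qed

section \<open>Systems of symmetric matrices\<close>

text \<open>
  The two commutation rules of \<open>R_gen\<close> are one rule \<open>S\<^sub>i S\<^sub>j = - \<epsilon>\<^sub>i \<epsilon>\<^sub>j S\<^sub>j S\<^sub>i\<close>.
\<close>

locale clifford_system =
  fixes p q :: nat and S :: "nat \<Rightarrow> real^'m^'m"
  assumes sym: "i \<in> {1..p+q} \<Longrightarrow> transpose (S i) = S i"
    and square: "i \<in> {1..p+q} \<Longrightarrow> S i ** S i = mat 1"
    and swap: "\<lbrakk>i \<in> {1..p+q}; j \<in> {1..p+q}; i \<noteq> j\<rbrakk> \<Longrightarrow>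
      S i ** S j = (- sgn_pq p i * sgn_pq p j) *\<^sub>R (S j ** S i)"
begin

abbreviation "idx \<equiv> {1..p+q}"
abbreviation "\<epsilon> \<equiv> sgn_pq p"

lemma eps_square [simp]: "\<epsilon> i * \<epsilon> i = 1"
  by (simp add: sgn_pq_def)

lemma eps_square_left [simp]: "\<epsilon> i * (\<epsilon> i * x) = x"
  by (simp add: sgn_pq_def)

lemma square_left: "i \<in> idx \<Longrightarrow> S i ** (S i ** A) = A"
  by (simp add: matrix_mul_assoc square)

text \<open>The matrix of the derivative of the form \<open>S i\<close> along the linear vector
  field \<open>X\<close>; this is the \<open>Y\<^sub>i\<close> of the overview.\<close>

definition act :: "real^'m^'m \<Rightarrow> nat \<Rightarrow> real^'m^'m" where
  "act X i = transpose X ** S i + S i ** X"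

lemma act_sym: "i \<in> idx \<Longrightarrow> transpose (act X i) = act X i"
  by (simp add: act_def transpose_alg sym add.commute)

lemma act_add: "act (X + Z) i = act X i + act Z i"
  by (simp add: act_def transpose_alg mat_alg)

lemma act_diff: "act (X - Z) i = act X i - act Z i"
  by (simp add: act_def transpose_alg mat_alg)

lemma act_scaleR: "act (c *\<^sub>R X) i = c *\<^sub>R act X i"
  by (simp add: act_def transpose_alg mat_alg scaleR_add_right)

lemma act_sum: "act (\<Sum>k\<in>K. X k) i = (\<Sum>k\<in>K. act (X k) i)"
  by (simp add: act_def transpose_alg mat_alg sum.distrib)

section \<open>Adjoint involutions and the number operator\<close>

text \<open>The adjoint of \<open>X\<close> for the bilinear form with matrix \<open>S i\<close>;
  its eigenspace for -1 is the Lie algebra of the isometry group of that form.\<close>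

definition reflect :: "nat \<Rightarrow> real^'m^'m \<Rightarrow> real^'m^'m" where
  "reflect i X = S i ** transpose X ** S i"

lemma reflect_add: "reflect i (X + Z) = reflect i X + reflect i Z"
  by (simp add: reflect_def transpose_alg mat_alg)

lemma reflect_scaleR: "reflect i (c *\<^sub>R X) = c *\<^sub>R reflect i X"
  by (simp add: reflect_def transpose_alg mat_alg)

lemma reflect_sum: "reflect i (\<Sum>k\<in>K. X k) = (\<Sum>k\<in>K. reflect i (X k))"
  by (simp add: reflect_def transpose_alg mat_alg)

lemma reflect_one: "i \<in> idx \<Longrightarrow> reflect i (mat 1) = mat 1"
  by (simp add: reflect_def square)

text \<open>Two adjoints compose to conjugation by \<open>S i ** S j\<close>; exchanging the factors
  on both sides of \<open>X\<close> costs the same sign twice.\<close>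

lemma reflect_commute:
  assumes "i \<in> idx" "j \<in> idx"
  shows "reflect i (reflect j X) = reflect j (reflect i X)"
proof (cases "i = j")
  case False
  have "reflect i (reflect j X) = (S i ** S j) ** X ** (S j ** S i)"
    using assms by (simp add: reflect_def transpose_alg sym matrix_mul_assoc)
  also have "\<dots> = (S j ** S i) ** X ** (S i ** S j)"
    using swap[OF assms False] swap[OF assms(2,1)] False by (simp add: mat_alg mult_ac)
  also have "\<dots> = reflect j (reflect i X)"
    using assms by (simp add: reflect_def transpose_alg sym matrix_mul_assoc)
  finally show ?thesis .
qed simp

lemma norm_reflect: "i \<in> idx \<Longrightarrow> norm (reflect i X) = norm X"
proof -
  assume i: "i \<in> idx"
  have "reflect i X \<bullet> reflect i X = trace (S i ** (X ** transpose X ** S i))"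
    using i by (simp add: inner_mat reflect_def transpose_alg sym square_left flip: matrix_mul_assoc)
  also have "\<dots> = trace (X ** transpose X)"
    using i by (subst trace_mul_sym) (simp add: square flip: matrix_mul_assoc)
  also have "\<dots> = X \<bullet> X"
    by (subst trace_mul_sym) (simp add: inner_mat)
  finally show ?thesis
    by (simp add: norm_eq_sqrt_inner)
qed

lemma S_act: "i \<in> idx \<Longrightarrow> S i ** act X i = X + reflect i X"
  by (simp add: act_def reflect_def mat_alg square_left matrix_mul_assoc square)

text \<open>The sum of the commuting projections onto the fixed spaces of the
  \<open>reflect i\<close>: on a joint eigenvector it counts the indices whose involution fixes
  it.\<close>

definition num :: "real^'m^'m \<Rightarrow> real^'m^'m" where
  "num X = (1/2) *\<^sub>R (\<Sum>i\<in>idx. X + reflect i X)"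

lemma num_add: "num (X + Z) = num X + num Z"
  by (simp add: num_def reflect_add sum.distrib algebra_simps)

lemma num_scaleR: "num (c *\<^sub>R X) = c *\<^sub>R num X"
  by (simp add: num_def reflect_scaleR scaleR_add_right[symmetric] scaleR_sum_right[symmetric])

lemma num_sum: "num (\<Sum>k\<in>K. X k) = (\<Sum>k\<in>K. num (X k))"
proof (induction K rule: infinite_finite_induct)
  case (insert x F)
  then show ?case by (simp add: num_add)
qed (simp_all add: num_def reflect_def transpose_alg mat_alg)

lemma num_reflect: "k \<in> idx \<Longrightarrow> num (reflect k X) = reflect k (num X)"
  unfolding num_def reflect_scaleR reflect_sum reflect_add
  by (intro arg_cong[of _ _ "\<lambda>Z. (1/2) *\<^sub>R Z"] sum.cong refl) (metis reflect_commute)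

lemma num_one: "num (mat 1) = real (p+q) *\<^sub>R mat 1"
proof -
  have "(\<Sum>i\<in>idx. mat 1 + reflect i (mat 1)) = (\<Sum>i\<in>idx. 2 *\<^sub>R (mat 1 :: real^'m^'m))"
    by (intro sum.cong refl) (metis reflect_one scaleR_2)
  then show ?thesis
    by (simp add: num_def sum_constant_scaleR del: sum_constant)
qed

text \<open>Each \<open>reflect i\<close> is an isometry, so Cauchy-Schwarz bounds every
  summand.\<close>

lemma inner_num_le: "X \<bullet> num X \<le> real (p+q) * (X \<bullet> X)"
proof -
  have "X \<bullet> reflect i X \<le> X \<bullet> X" if "i \<in> idx" for i
    using norm_cauchy_schwarz[of X "reflect i X"] norm_reflect[OF that, of X]
    by (simp add: power2_norm_eq_inner[symmetric] power2_eq_square)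
  then have "(\<Sum>i\<in>idx. X \<bullet> X + X \<bullet> reflect i X) \<le> (\<Sum>i\<in>idx. 2 * (X \<bullet> X))"
    by (intro sum_mono) fastforce
  then show ?thesis
    by (simp add: num_def inner_sum_right inner_add_right)
qed

section \<open>Products of two generators\<close>

text \<open>\<open>S i ** S j\<close> acts as an infinitesimal rotation or boost in the plane of
  \<open>S i\<close> and \<open>S j\<close>. For a third index \<open>k\<close> the sign
  \<open>\<epsilon> k\<close> enters twice and drops out, and the two terms cancel.\<close>

lemma act_pair:
  assumes "i \<in> idx" "j \<in> idx" "k \<in> idx" "i \<noteq> j"
  shows "act (S i ** S j) k =
    (if k = i then 2 *\<^sub>R S j else if k = j then (- 2 * \<epsilon> i * \<epsilon> j) *\<^sub>R S i else 0)"
proof -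
  have e: "act (S i ** S j) k = S j ** S i ** S k + S k ** S i ** S j"
    using assms by (simp add: act_def transpose_alg sym matrix_mul_assoc)
  have ji: "S j ** S i = (- \<epsilon> i * \<epsilon> j) *\<^sub>R (S i ** S j)"
    using swap[of j i] assms by (simp add: mult.commute)
  consider "k = i" | "k = j" | "k \<noteq> i" "k \<noteq> j" by blast
  then show ?thesis
  proof cases
    case 1
    then show ?thesis
      using assms unfolding e by (simp add: square matrix_mul_assoc[symmetric] scaleR_2)
  next
    case 2
    have "S j ** S i ** S j = (- \<epsilon> i * \<epsilon> j) *\<^sub>R S i"
      using assms unfolding ji by (simp add: mat_alg square flip: matrix_mul_assoc)
    then show ?thesis
      using assms 2 unfolding e by (simp add: numeral_times_mat mult.assoc mult.commute[of 2 "_ :: real"])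
  next
    case 3
    have "S k ** S i ** S j = (\<epsilon> i * \<epsilon> j) *\<^sub>R (S i ** S j ** S k)"
      using swap[of k i] swap[of k j] assms 3
      by (simp add: mat_alg mult_ac) (simp add: mat_alg mult_ac flip: matrix_mul_assoc)
    then show ?thesis
      using 3 unfolding e ji by (simp add: mat_alg)
  qed
qed

text \<open>Read off from \<open>act_pair\<close> through \<open>S_act\<close>: products of two
  generators are joint eigenvectors of the involutions.\<close>

lemma reflect_pair:
  assumes "i \<in> idx" "j \<in> idx" "k \<in> idx" "i \<noteq> j"
  shows "reflect k (S i ** S j) = (if k = i \<or> k = j then S i ** S j else - (S i ** S j))"
proof -
  have "S i ** S j + reflect k (S i ** S j) = S k ** act (S i ** S j) k"
    using assms by (simp add: S_act)
  also have "\<dots> = (if k = i \<or> k = j then 2 *\<^sub>R (S i ** S j) else 0)"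
  proof -
    have "(- 2 * \<epsilon> i * \<epsilon> j) *\<^sub>R (S j ** S i) = 2 *\<^sub>R (S i ** S j)"
      unfolding swap[OF assms(1,2,4)] by simp
    then show ?thesis
      using assms by (auto simp: act_pair mat_alg)
  qed
  finally show ?thesis
    by (auto simp: scaleR_2 add_eq_0_iff)
qed

text \<open>Exactly the involutions of the two indices \<open>i\<close> and \<open>j\<close> fix the
  product, whence the eigenvalue 2.\<close>

lemma num_pair:
  assumes "i \<in> idx" "j \<in> idx" "i \<noteq> j"
  shows "num (S i ** S j) = 2 *\<^sub>R (S i ** S j)"
proof -
  have "(\<Sum>k\<in>idx. S i ** S j + reflect k (S i ** S j)) = (\<Sum>k\<in>idx. if k \<in> {i, j} then 2 *\<^sub>R (S i ** S j) else 0)"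
    using assms by (intro sum.cong refl) (auto simp: reflect_pair scaleR_2)
  also have "\<dots> = (\<Sum>k\<in>{i, j}. 2 *\<^sub>R (S i ** S j))"
    using assms by (intro sum.mono_neutral_cong_right) auto
  finally show ?thesis
    using assms by (simp add: num_def scaleR_2)
qed

section \<open>The action of the Lie algebra on the span of the generators\<close>

definition g_set :: "(real^'m^'m) set" where
  "g_set = {X. \<forall>w. (\<Sum>i\<in>idx. \<epsilon> i * qform (S i) w * qform (act X i) w) = 0}"

definition so_set :: "(nat \<Rightarrow> nat \<Rightarrow> real) set" where
  "so_set = lie_carrier (so_lie p q)"

lemma so_set_iff:
  "A \<in> so_set \<longleftrightarrow> (\<forall>i j. i \<notin> idx \<or> j \<notin> idx \<longrightarrow> A i j = 0) \<and>
     (\<forall>i\<in>idx. \<forall>j\<in>idx. A i j = - (\<epsilon> i * \<epsilon> j * A j i))"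
proof -
  have "A j i * \<epsilon> j + \<epsilon> i * A i j = 0 \<longleftrightarrow> A i j = - (\<epsilon> i * \<epsilon> j * A j i)" for i j
    by (auto simp: sgn_pq_def)
  then show ?thesis
    by (simp add: so_set_def so_lie_def)
qed

text \<open>Contraction with \<open>S k\<close> gives a linear equation for
  \<open>S k ** act X k\<close> whose operator is injective by \<open>big\<close>. Its right-hand
  side is a combination of eigenvectors of \<open>num\<close>, so a solution can be written down,
  and it is the only one.\<close>

lemma act_in_span:
  assumes orth: "\<And>i j. \<lbrakk>i \<in> idx; j \<in> idx; i \<noteq> j\<rbrakk> \<Longrightarrow> trace (S i ** S j) = 0"
    and big: "4 * (p + q) < CARD('m) + 8"
    and X: "X \<in> g_set"
  shows "\<exists>A\<in>so_set. \<forall>k\<in>idx. act X k = (\<Sum>i\<in>idx. A k i *\<^sub>R S i)"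
proof -
  define m n where "m = real CARD('m)" and "n = real (p + q)"
  have mn: "m + 8 - 4 * n > 0" "m > 0"
    using big by (simp_all add: m_def n_def)
  define c where "c i k = trace (act X i ** S k)" for i k
  have gram: "trace (S i ** S k) = (if i = k then m else 0)" if "i \<in> idx" "k \<in> idx" for i k
    using orth[OF that] that by (simp add: square trace_I m_def)
  define T where "T = (\<Sum>i\<in>idx. S i ** act X i)"
  have T: "T = 2 *\<^sub>R num X"
    unfolding T_def num_def by (simp, intro sum.cong refl) (simp add: S_act)
  define V where "V k = S k ** act X k" for k
  define L where "L k = (\<Sum>i\<in>idx. (\<epsilon> i * c i k) *\<^sub>R S i)" for k
  have contr: "(m + 8) *\<^sub>R V k - 4 *\<^sub>R num (V k) = - \<epsilon> k *\<^sub>R (S k ** L k)" if k: "k \<in> idx" for k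
  proof -
    have "0 = (\<Sum>i\<in>idx. trace (act X i ** S k) *\<^sub>R (\<epsilon> i *\<^sub>R S i) + trace ((\<epsilon> i *\<^sub>R S i) ** S k) *\<^sub>R act X i +
           2 *\<^sub>R ((\<epsilon> i *\<^sub>R S i) ** S k ** act X i + act X i ** S k ** (\<epsilon> i *\<^sub>R S i)))"
      using X k by (intro quartic_contraction[symmetric])
        (auto simp: g_set_def act_sym sym transpose_alg qform_scaleR)
    \<comment> \<open>At \<open>i = k\<close> the factors commute instead of picking up the sign of
      the other indices. The correction \<open>4 *\<^sub>R act X k\<close> allows one formula for
      all \<open>i\<close> and becomes the 8 in \<open>m + 8\<close>.\<close>
    also have "\<dots> = (\<Sum>i\<in>idx. (\<epsilon> i * c i k) *\<^sub>R S i + (if i = k then (m * \<epsilon> k) *\<^sub>R act X k else 0) +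
        (2 * \<epsilon> k) *\<^sub>R ((if i = k then 4 *\<^sub>R act X k else 0)
            - (S k ** (S i ** act X i) + (act X i ** S i) ** S k)))"
    proof (intro sum.cong refl)
      fix i assume i: "i \<in> idx"
      show "trace (act X i ** S k) *\<^sub>R (\<epsilon> i *\<^sub>R S i) + trace ((\<epsilon> i *\<^sub>R S i) ** S k) *\<^sub>R act X i +
           2 *\<^sub>R ((\<epsilon> i *\<^sub>R S i) ** S k ** act X i + act X i ** S k ** (\<epsilon> i *\<^sub>R S i))
        = (\<epsilon> i * c i k) *\<^sub>R S i + (if i = k then (m * \<epsilon> k) *\<^sub>R act X k else 0) +
        (2 * \<epsilon> k) *\<^sub>R ((if i = k then 4 *\<^sub>R act X k else 0)
            - (S k ** (S i ** act X i) + (act X i ** S i) ** S k))"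
      proof (cases "i = k")
        case True
        then show ?thesis
          using k by (simp add: c_def mat_alg trace_alg gram square square_left)
            (simp add: square square_left numeral_times_mat trace_I m_def algebra_simps flip: matrix_mul_assoc)
      next
        case False
        have 1: "S i ** S k = (- \<epsilon> i * \<epsilon> k) *\<^sub>R (S k ** S i)"
          and 2: "S k ** S i = (- \<epsilon> i * \<epsilon> k) *\<^sub>R (S i ** S k)"
          using swap[OF i k] swap[OF k i] False by (simp_all add: mult.commute)
        have "(\<epsilon> i *\<^sub>R S i) ** S k ** act X i = - \<epsilon> k *\<^sub>R (S k ** (S i ** act X i))"
          by (simp add: mat_alg 1 matrix_mul_assoc)
        moreover have "act X i ** S k ** (\<epsilon> i *\<^sub>R S i) = - \<epsilon> k *\<^sub>R ((act X i ** S i) ** S k)"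
          by (simp add: mat_alg matrix_mul_assoc[symmetric] 2)
        ultimately show ?thesis
          using False i k by (simp add: c_def mat_alg trace_alg gram algebra_simps)
      qed
    qed
    also have "\<dots> = L k + (m * \<epsilon> k) *\<^sub>R act X k + (2 * \<epsilon> k) *\<^sub>R (4 *\<^sub>R act X k
        - (S k ** T + transpose T ** S k))"
    proof -
      have "transpose T = (\<Sum>i\<in>idx. act X i ** S i)"
        unfolding T_def transpose_alg by (intro sum.cong refl) (simp add: act_sym sym)
      then show ?thesis
        using k by (simp add: sum.distrib L_def sum_subtractf T_def mat_alg scaleR_sum_right[symmetric])
    qed
    finally have "0 = \<epsilon> k *\<^sub>R (S k ** (L k + (m * \<epsilon> k) *\<^sub>R act X k + (2 * \<epsilon> k) *\<^sub>R (4 *\<^sub>R act X k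
        - (S k ** T + transpose T ** S k))))"
      by (metis mat_zero_right scaleR_zero_right)
    also have "\<dots> = \<epsilon> k *\<^sub>R (S k ** L k) + (m + 8) *\<^sub>R V k - 2 *\<^sub>R (T + reflect k T)"
      using k by (simp add: mat_alg V_def reflect_def square_left matrix_mul_assoc[symmetric] algebra_simps)
    \<comment> \<open>Since \<open>num\<close> commutes with \<open>reflect k\<close>, the two terms
      combine to \<open>num\<close> of \<open>X + reflect k X\<close>, which is
      \<open>V k\<close>.\<close>
    also have "2 *\<^sub>R (T + reflect k T) = 4 *\<^sub>R num (V k)"
      using k by (simp add: T V_def S_act num_add num_reflect reflect_scaleR scaleR_add_right)
    finally show ?thesis
      by (simp add: algebra_simps)
  qed
  have inj: "Z = 0" if "(m + 8) *\<^sub>R Z - 4 *\<^sub>R num Z = 0" for Z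
  proof -
    \<comment> \<open>Pairing with \<open>Z\<close> compares \<open>m + 8\<close> with the upper
      bound \<open>4 * n\<close> of four times \<open>num\<close>.\<close>
    have "(m + 8) * (Z \<bullet> Z) = 4 * (Z \<bullet> num Z)"
      using arg_cong[OF that, of "\<lambda>U. Z \<bullet> U"] by (simp add: inner_diff_right)
    also have "\<dots> \<le> 4 * n * (Z \<bullet> Z)"
      using mult_left_mono[OF inner_num_le[of Z], of 4] by (simp add: n_def algebra_simps)
    finally have "(m + 8 - 4 * n) * (Z \<bullet> Z) \<le> 0"
      by (simp add: algebra_simps)
    with mn show ?thesis
      using inner_gt_zero_iff[of Z] by (fastforce simp: mult_le_0_iff)
  qed
  \<comment> \<open>This inverts the operator on the eigenvectors \<open>S k ** S i\<close>: its
    eigenvalue is \<open>m\<close> for \<open>i \<noteq> k\<close>, where \<open>num\<close> acts as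
    2, and \<open>m + 8 - 4 * n\<close> for \<open>i = k\<close>, where the product is the
    identity.\<close>
  define d where "d k i = (if i = k then m / (m + 8 - 4 * n) else 1) * (- \<epsilon> k * \<epsilon> i * c i k / m)" for k i
  have V: "V k = (\<Sum>i\<in>idx. d k i *\<^sub>R (S k ** S i))" if k: "k \<in> idx" for k
  proof -
    have "(m + 8) *\<^sub>R (d k i *\<^sub>R (S k ** S i)) - 4 *\<^sub>R num (d k i *\<^sub>R (S k ** S i))
        = (- \<epsilon> k * \<epsilon> i * c i k) *\<^sub>R (S k ** S i)" if i: "i \<in> idx" for i
    proof -
      define e where "e = (if i = k then n else 2)"
      have "num (S k ** S i) = e *\<^sub>R (S k ** S i)"
        using i k by (simp add: e_def num_pair num_one square n_def)
      then have "(m + 8) *\<^sub>R (d k i *\<^sub>R (S k ** S i)) - 4 *\<^sub>R num (d k i *\<^sub>R (S k ** S i))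
          = (d k i * (m + 8 - 4 * e)) *\<^sub>R (S k ** S i)"
        unfolding num_scaleR by (simp add: scaleR_diff_left[symmetric] right_diff_distrib mult_ac del: scaleR_diff_left)
      also have "d k i * (m + 8 - 4 * e) = - \<epsilon> k * \<epsilon> i * c i k"
        using mn by (auto simp: d_def e_def)
      finally show ?thesis .
    qed
    then have "(\<Sum>i\<in>idx. (m + 8) *\<^sub>R (d k i *\<^sub>R (S k ** S i)) - 4 *\<^sub>R num (d k i *\<^sub>R (S k ** S i)))
        = (\<Sum>i\<in>idx. (- \<epsilon> k * \<epsilon> i * c i k) *\<^sub>R (S k ** S i))"
      by (intro sum.cong refl) blast
    also have "\<dots> = - \<epsilon> k *\<^sub>R (S k ** L k)"
      by (simp add: L_def mat_alg scaleR_sum_right mult.assoc)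
    finally have sum_eq: "(\<Sum>i\<in>idx. (m + 8) *\<^sub>R (d k i *\<^sub>R (S k ** S i)) - 4 *\<^sub>R num (d k i *\<^sub>R (S k ** S i)))
        = - \<epsilon> k *\<^sub>R (S k ** L k)" .
    define Z where "Z = (\<Sum>i\<in>idx. d k i *\<^sub>R (S k ** S i))"
    have Z: "(m + 8) *\<^sub>R Z - 4 *\<^sub>R num Z = - \<epsilon> k *\<^sub>R (S k ** L k)"
      unfolding sum_eq[symmetric] Z_def num_sum sum_subtractf scaleR_sum_right ..
    have diff: "num (V k - Z) = num (V k) - num Z"
      using num_add[of "V k" "-1 *\<^sub>R Z"] num_scaleR[of "-1" Z] by simp
    have regroup: "(a - b') - (b - d') = (a - b) - (b' - d')" for a b b' d' :: "real^'m^'m"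
      by simp
    have "(m + 8) *\<^sub>R (V k - Z) - 4 *\<^sub>R num (V k - Z) = 0"
      unfolding diff scaleR_diff_right
      by (subst regroup) (simp only: Z contr[OF k] diff_self)
    then have "V k - (\<Sum>i\<in>idx. d k i *\<^sub>R (S k ** S i)) = 0"
      unfolding Z_def by (rule inj)
    then show ?thesis by simp
  qed
  have act: "act X k = (\<Sum>i\<in>idx. d k i *\<^sub>R S i)" if k: "k \<in> idx" for k
  proof -
    have "act X k = S k ** V k"
      using k by (simp add: V_def square_left)
    then show ?thesis
      using k by (simp add: V mat_alg square_left)
  qed
  \<comment> \<open>Traces against \<open>S j\<close> express \<open>c\<close> by \<open>d\<close>,
    whereas \<open>d k i\<close> was defined from the transposed entry \<open>c i k\<close>;
    together this makes \<open>d\<close> skew up to the signs.\<close>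
  have c: "c k j = d k j * m" if "k \<in> idx" "j \<in> idx" for k j
  proof -
    have "c k j = (\<Sum>i\<in>idx. d k i * trace (S i ** S j))"
      using that by (simp add: c_def act mat_alg trace_alg)
    also have "\<dots> = (\<Sum>i\<in>idx. d k i * (if i = j then m else 0))"
      by (intro sum.cong refl) (simp only: gram that)
    also have "\<dots> = d k j * m"
      using that by (simp add: if_distrib sum.delta cong: if_cong)
    finally show ?thesis .
  qed
  have diag: "d k k = 0" if k: "k \<in> idx" for k
  proof -
    \<comment> \<open>On the diagonal both relations involve the same entry, and the resulting
      factor \<open>2 * m + 8 - 4 * n\<close> is positive.\<close>
    have "d k k * (m + 8 - 4 * n) = - (d k k * m)"
      using mn c[OF k k] by (simp add: d_def)
    then have "d k k * (2 * m + 8 - 4 * n) = 0"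
      by (simp add: algebra_simps)
    with mn show ?thesis by simp
  qed
  have anti: "d i j = - (\<epsilon> i * \<epsilon> j * d j i)" if "i \<in> idx" "j \<in> idx" for i j
    using that c[OF that(2,1)] mn diag by (cases "i = j") (simp_all add: d_def[of i j])
  show ?thesis
    by (rule bexI[of _ "\<lambda>i j. if i \<in> idx \<and> j \<in> idx then d i j else 0"])
      (auto simp: so_set_iff act intro: anti)
qed

section \<open>Splitting off the annihilator of the generators\<close>

definition h_set :: "(real^'m^'m) set" where
  "h_set = {X. \<forall>i\<in>idx. act X i = 0}"

text \<open>The spin embedding of \<open>so(p,q)\<close>. The factor 1/4 compensates the 2 in
  \<open>act_pair\<close> and the double occurrence of each pair of indices.\<close>

definition phi :: "(nat \<Rightarrow> nat \<Rightarrow> real) \<Rightarrow> real^'m^'m" where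
  "phi A = (1/4) *\<^sub>R (\<Sum>k\<in>idx. \<Sum>i\<in>idx. A k i *\<^sub>R (S k ** S i))"

text \<open>The zero entries outside \<open>idx\<close> make the matrix \<open>A\<close> unique once
  the generators are independent.\<close>

definition represents :: "real^'m^'m \<Rightarrow> (nat \<Rightarrow> nat \<Rightarrow> real) \<Rightarrow> bool" where
  "represents X A \<longleftrightarrow> (\<forall>i j. i \<notin> idx \<or> j \<notin> idx \<longrightarrow> A i j = 0) \<and>
     (\<forall>k\<in>idx. act X k = (\<Sum>i\<in>idx. A k i *\<^sub>R S i))"

abbreviation "br \<equiv> lie_bracket (so_lie p q)"

lemma br_eq: "br A B i j = (\<Sum>k\<in>idx. A i k * B k j) - (\<Sum>k\<in>idx. B i k * A k j)"
  by (simp add: so_lie_def)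

lemma so_diag: "A \<in> so_set \<Longrightarrow> A k k = 0"
proof (cases "k \<in> idx")
  case True
  assume "A \<in> so_set"
  then have "A k k = - (\<epsilon> k * \<epsilon> k * A k k)"
    using True unfolding so_set_iff by blast
  then show ?thesis by simp
qed (simp add: so_set_iff)

lemma act_phi:
  assumes A: "A \<in> so_set" and k: "k \<in> idx"
  shows "act (phi A) k = (\<Sum>i\<in>idx. A k i *\<^sub>R S i)"
proof -
  have "A j i *\<^sub>R act (S j ** S i) k =
      (if j = k then (2 * A k i) *\<^sub>R S i else 0) + (if i = k then (2 * A k j) *\<^sub>R S j else 0)"
    if i: "i \<in> idx" and j: "j \<in> idx" for i j
  proof (cases "i = j")
    case True
    then show ?thesis by (simp add: so_diag[OF A])
  next
    case False
    \<comment> \<open>The skewness of \<open>A\<close> absorbs the sign that \<open>act_pair\<close>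
      produces when \<open>k\<close> is the second index, so both positions contribute
      alike.\<close>
    have "A k j = - (\<epsilon> k * \<epsilon> j * A j k)"
      using A k j unfolding so_set_iff by blast
    then show ?thesis
      using act_pair[OF j i k] False by (auto simp: mult_ac)
  qed
  then have "act (phi A) k = (1/4) *\<^sub>R (\<Sum>j\<in>idx. \<Sum>i\<in>idx.
      (if j = k then (2 * A k i) *\<^sub>R S i else 0) + (if i = k then (2 * A k j) *\<^sub>R S j else 0))"
    unfolding phi_def act_scaleR act_sum
    by (intro arg_cong[of _ _ "\<lambda>Z. (1/4) *\<^sub>R Z"] sum.cong refl) blast
  also have "\<dots> = (1/4) *\<^sub>R ((\<Sum>i\<in>idx. \<Sum>j\<in>idx. if j = k then (2 * A k i) *\<^sub>R S i else 0) +
      (\<Sum>j\<in>idx. \<Sum>i\<in>idx. if i = k then (2 * A k j) *\<^sub>R S j else 0))"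
    unfolding sum.distrib by (subst (1) sum.swap) simp
  also have "\<dots> = (1/4) *\<^sub>R ((\<Sum>i\<in>idx. (2 * A k i) *\<^sub>R S i) + (\<Sum>i\<in>idx. (2 * A k i) *\<^sub>R S i))"
    using k by (simp add: sum.delta)
  also have "\<dots> = (\<Sum>i\<in>idx. A k i *\<^sub>R S i)"
    by (simp add: sum.distrib[symmetric] scaleR_add_left[symmetric] scaleR_sum_right del: scaleR_add_left)
  finally show ?thesis .
qed

text \<open>Acting with \<open>X\<close> and then with \<open>Z\<close> expands rows through
  \<open>A\<close> and then through \<open>B\<close>, so the matrices multiply in the order
  \<open>A\<close>, \<open>B\<close> and the bracket is preserved without a sign.\<close>

lemma act_bracket:
  assumes X: "represents X A" and Z: "represents Z B"
  shows "represents (X ** Z - Z ** X) (br A B)"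
  unfolding represents_def
proof (intro conjI allI impI ballI)
  fix i j assume "i \<notin> idx \<or> j \<notin> idx"
  then show "br A B i j = 0"
    using X Z unfolding br_eq represents_def by (auto intro!: sum.neutral)
next
  fix k assume k: "k \<in> idx"
  have D: "transpose U ** act V k + act V k ** U = (\<Sum>j\<in>idx. (\<Sum>i\<in>idx. D k i * C i j) *\<^sub>R S j)"
    if U: "represents U C" and V: "represents V D" for U V C D
  proof -
    have "transpose U ** act V k + act V k ** U = (\<Sum>i\<in>idx. D k i *\<^sub>R act U i)"
      using V k by (simp add: represents_def act_def mat_alg sum.distrib scaleR_add_right)
    also have "\<dots> = (\<Sum>i\<in>idx. \<Sum>j\<in>idx. (D k i * C i j) *\<^sub>R S j)"
      using U by (intro sum.cong refl) (simp add: represents_def scaleR_sum_right)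
    also have "\<dots> = (\<Sum>j\<in>idx. (\<Sum>i\<in>idx. D k i * C i j) *\<^sub>R S j)"
      by (subst sum.swap) (simp add: scaleR_sum_left)
    finally show ?thesis .
  qed
  have "act (X ** Z - Z ** X) k = (transpose Z ** act X k + act X k ** Z) - (transpose X ** act Z k + act Z k ** X)"
    by (simp add: act_def mat_alg transpose_alg matrix_mul_assoc)
  then show "act (X ** Z - Z ** X) k = (\<Sum>i\<in>idx. br A B k i *\<^sub>R S i)"
    by (simp add: D[OF X Z] D[OF Z X] br_eq scaleR_diff_left sum_subtractf)
qed

text \<open>With \<open>X = phi A\<close> this shows that \<open>phi\<close> preserves brackets;
  with \<open>X\<close> in \<open>h_set\<close>, where \<open>A\<close> is zero, it shows that the
  image of \<open>phi\<close> commutes with \<open>h_set\<close>.\<close>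

lemma bracket_phi:
  assumes X: "represents X A" and A: "A \<in> so_set"
  shows "X ** phi B - phi B ** X = phi (br A B)"
proof -
  have *: "X ** (S k ** S i) - (S k ** S i) ** X =
      (\<Sum>j\<in>idx. A j k *\<^sub>R (S j ** S i)) - (\<Sum>j\<in>idx. A i j *\<^sub>R (S k ** S j))"
    if k: "k \<in> idx" and i: "i \<in> idx" for k i
  proof -
    \<comment> \<open>The two terms \<open>S k ** transpose X ** S i\<close> on the right
      cancel.\<close>
    have "X ** (S k ** S i) - (S k ** S i) ** X = S k ** act X k ** S k ** S i - S k ** act X i"
      using k by (simp add: act_def mat_alg matrix_mul_assoc square)
        (simp add: square square_left flip: matrix_mul_assoc)
    also have "S k ** act X k ** S k ** S i = (\<Sum>j\<in>idx. A k j *\<^sub>R (S k ** S j ** S k ** S i))"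
      using X k by (simp add: represents_def mat_alg)
    also have "\<dots> = (\<Sum>j\<in>idx. A j k *\<^sub>R (S j ** S i))"
    proof (intro sum.cong refl)
      fix j assume j: "j \<in> idx"
      have a: "A j k = - (\<epsilon> j * \<epsilon> k * A k j)"
        using A j k unfolding so_set_iff by blast
      show "A k j *\<^sub>R (S k ** S j ** S k ** S i) = A j k *\<^sub>R (S j ** S i)"
      proof (cases "j = k")
        case False
        then show ?thesis
          using swap[of k j] j k a by (simp add: mat_alg mult_ac)
            (simp add: square square_left flip: matrix_mul_assoc)
      qed (simp add: so_diag[OF A])
    qed
    also have "S k ** act X i = (\<Sum>j\<in>idx. A i j *\<^sub>R (S k ** S j))"
      using X i by (simp add: represents_def mat_alg)
    finally show ?thesis .
  qed
  have "4 *\<^sub>R (X ** phi B - phi B ** X) = (\<Sum>k\<in>idx. \<Sum>i\<in>idx. B k i *\<^sub>R (X ** (S k ** S i) - (S k ** S i) ** X))"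
    by (simp add: phi_def mat_alg scaleR_diff_right sum_subtractf)
  also have "\<dots> = (\<Sum>k\<in>idx. \<Sum>i\<in>idx. \<Sum>j\<in>idx. (A j k * B k i) *\<^sub>R (S j ** S i)) -
      (\<Sum>k\<in>idx. \<Sum>i\<in>idx. \<Sum>j\<in>idx. (B k i * A i j) *\<^sub>R (S k ** S j))"
    unfolding sum_subtractf[symmetric]
    by (intro sum.cong refl) (simp only: *, simp add: scaleR_diff_right scaleR_sum_right sum_subtractf mult_ac)
  also have "(\<Sum>k\<in>idx. \<Sum>i\<in>idx. \<Sum>j\<in>idx. (A j k * B k i) *\<^sub>R (S j ** S i)) =
      (\<Sum>j\<in>idx. \<Sum>i\<in>idx. (\<Sum>k\<in>idx. A j k * B k i) *\<^sub>R (S j ** S i))"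
  proof -
    have "(\<Sum>k\<in>idx. \<Sum>i\<in>idx. \<Sum>j\<in>idx. (A j k * B k i) *\<^sub>R (S j ** S i)) =
        (\<Sum>k\<in>idx. \<Sum>j\<in>idx. \<Sum>i\<in>idx. (A j k * B k i) *\<^sub>R (S j ** S i))"
      by (rule sum.cong[OF refl], rule sum.swap)
    also have "\<dots> = (\<Sum>j\<in>idx. \<Sum>k\<in>idx. \<Sum>i\<in>idx. (A j k * B k i) *\<^sub>R (S j ** S i))"
      by (rule sum.swap)
    also have "\<dots> = (\<Sum>j\<in>idx. \<Sum>i\<in>idx. \<Sum>k\<in>idx. (A j k * B k i) *\<^sub>R (S j ** S i))"
      by (rule sum.cong[OF refl], rule sum.swap)
    finally show ?thesis by (simp add: scaleR_sum_left)
  qed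
  also have "(\<Sum>k\<in>idx. \<Sum>i\<in>idx. \<Sum>j\<in>idx. (B k i * A i j) *\<^sub>R (S k ** S j)) =
      (\<Sum>k\<in>idx. \<Sum>j\<in>idx. (\<Sum>i\<in>idx. B k i * A i j) *\<^sub>R (S k ** S j))"
    unfolding scaleR_sum_left by (rule sum.cong[OF refl], rule sum.swap)
  finally have "4 *\<^sub>R (X ** phi B - phi B ** X) = 4 *\<^sub>R phi (br A B)"
    by (simp add: phi_def br_eq scaleR_diff_left sum_subtractf)
  then show ?thesis
    by (metis scaleR_cancel_left zero_neq_numeral)
qed

lemma phi_linear: "phi (\<lambda>i j. A i j + B i j) = phi A + phi B" "phi (\<lambda>i j. c * A i j) = c *\<^sub>R phi A"
  by (simp_all add: phi_def scaleR_add_left sum.distrib scaleR_add_right scaleR_sum_right mult_ac)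

text \<open>By skewness the double sum over \<open>k\<close> and \<open>i\<close> changes sign when
  the two indices are exchanged.\<close>

lemma g_set_represents:
  assumes "A \<in> so_set" "represents X A"
  shows "X \<in> g_set"
proof -
  have "(\<Sum>k\<in>idx. \<epsilon> k * qform (S k) w * qform (act X k) w) = 0" for w
  proof -
    let ?f = "\<lambda>k i. \<epsilon> k * A k i * qform (S k) w * qform (S i) w"
    have "(\<Sum>k\<in>idx. \<epsilon> k * qform (S k) w * qform (act X k) w) = (\<Sum>k\<in>idx. \<Sum>i\<in>idx. ?f k i)"
      using assms(2) by (intro sum.cong refl)
        (simp add: represents_def qform_sum qform_scaleR sum_distrib_left mult_ac)
    moreover have "(\<Sum>k\<in>idx. \<Sum>i\<in>idx. ?f k i) = (\<Sum>k\<in>idx. \<Sum>i\<in>idx. - ?f i k)"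
    proof (intro sum.cong refl)
      fix k i assume "k \<in> idx" "i \<in> idx"
      then have "A k i = - (\<epsilon> k * \<epsilon> i * A i k)"
        using assms(1) unfolding so_set_iff by blast
      then show "?f k i = - ?f i k" by (simp add: mult_ac)
    qed
    moreover have "(\<Sum>k\<in>idx. \<Sum>i\<in>idx. - ?f i k) = - (\<Sum>k\<in>idx. \<Sum>i\<in>idx. ?f k i)"
      by (subst sum.swap) (simp add: sum_negf)
    ultimately show ?thesis by simp
  qed
  then show ?thesis by (simp add: g_set_def)
qed

text \<open>The isomorphism sends \<open>X\<close> to the matrix of its action together with
  \<open>X - phi (coef X)\<close>, which annihilates every generator. The two hypotheses are
  obtained in different ways for \<open>p + q = 2\<close> and for the other values.\<close>

theorem lie_isomorphic_g:
  assumes indep: "\<And>a k. \<lbrakk>(\<Sum>i\<in>idx. a i *\<^sub>R S i) = 0; k \<in> idx\<rbrakk> \<Longrightarrow> a k = 0"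
    and act_span: "\<And>X. X \<in> g_set \<Longrightarrow> \<exists>A\<in>so_set. \<forall>k\<in>idx. act X k = (\<Sum>i\<in>idx. A k i *\<^sub>R S i)"
  shows "lie_isomorphic (matrix_lie g_set) (lie_direct_sum (so_lie p q) (matrix_lie h_set))"
proof -
  have unique: "A = B" if "represents X A" "represents X B" for X A B
  proof (intro ext)
    fix k i
    have "A k i - B k i = 0" if "k \<in> idx" "i \<in> idx"
      using that \<open>represents X A\<close> \<open>represents X B\<close>
      by (intro indep[of "\<lambda>i. A k i - B k i"]) (simp_all add: represents_def scaleR_diff_left sum_subtractf)
    then show "A k i = B k i"
      using that by (cases "k \<in> idx \<and> i \<in> idx") (auto simp: represents_def)
  qed
  define coef where "coef X = (THE A. represents X A)" for X
  have coefI: "coef X = A" if "represents X A" for X A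
    unfolding coef_def using that unique by (blast intro: the_equality)
  have coef: "coef X \<in> so_set" "represents X (coef X)" if "X \<in> g_set" for X
  proof -
    obtain A where A: "A \<in> so_set" "\<forall>k\<in>idx. act X k = (\<Sum>i\<in>idx. A k i *\<^sub>R S i)"
      using act_span[OF \<open>X \<in> g_set\<close>] by blast
    then have X: "represents X A"
      unfolding represents_def so_set_iff by blast
    show "coef X \<in> so_set" "represents X (coef X)"
      unfolding coefI[OF X] by (fact A(1) X)+
  qed
  have represents_phi: "represents (phi A) A" if "A \<in> so_set" for A
    using that act_phi[OF that] unfolding represents_def so_set_iff by blast
  have represents_h: "represents (X + H) A" if "represents X A" "H \<in> h_set" for X H A
    using that by (simp add: represents_def h_set_def act_add)
  let ?f = "\<lambda>X. (coef X, X - phi (coef X))"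
  let ?g = "\<lambda>(A, H). phi A + H"
  have so: "lie_carrier (so_lie p q) = so_set"
    by (simp add: so_set_def)
  have "bij_betw ?f g_set (so_set \<times> h_set)"
  proof (rule bij_betw_byWitness[where f' = ?g])
    show "\<forall>X\<in>g_set. ?g (?f X) = X" by simp
    show "\<forall>P\<in>so_set \<times> h_set. ?f (?g P) = P"
      by (auto simp: coefI[OF represents_h[OF represents_phi]])
    show "?f ` g_set \<subseteq> so_set \<times> h_set"
      using coef act_phi by (auto simp: h_set_def act_diff represents_def)
    show "?g ` (so_set \<times> h_set) \<subseteq> g_set"
      using g_set_represents represents_h represents_phi by auto
  qed
  moreover have "coef (X + Z) = (\<lambda>i j. coef X i j + coef Z i j)" if "X \<in> g_set" "Z \<in> g_set" for X Z
    using coef[OF that(1)] coef[OF that(2)]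
    by (intro coefI) (simp add: represents_def act_add scaleR_add_left sum.distrib)
  moreover have "coef (c *\<^sub>R X) = (\<lambda>i j. c * coef X i j)" if "X \<in> g_set" for X c
    using coef[OF that] by (intro coefI) (simp add: represents_def act_scaleR scaleR_sum_right)
  moreover have "coef (X ** Z - Z ** X) = br (coef X) (coef Z)" if "X \<in> g_set" "Z \<in> g_set" for X Z
    using coef(2)[OF that(1)] coef(2)[OF that(2)] by (intro coefI act_bracket)
  \<comment> \<open>All three commutators with a value of \<open>phi\<close> are plus or minus
    \<open>phi\<close> of the same bracket; exactly one survives the cancellation.\<close>
  moreover have "X ** Z - Z ** X - phi (br (coef X) (coef Z)) =
      (X - phi (coef X)) ** (Z - phi (coef Z)) - (Z - phi (coef Z)) ** (X - phi (coef X))"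
    if "X \<in> g_set" "Z \<in> g_set" for X Z
  proof -
    note X = coef[OF that(1)] and Z = coef[OF that(2)]
    have "br (coef Z) (coef X) = (\<lambda>i j. (-1) * br (coef X) (coef Z) i j)"
      by (simp add: br_eq fun_eq_iff)
    then have "phi (br (coef Z) (coef X)) = - phi (br (coef X) (coef Z))"
      by (simp only: phi_linear) simp
    with bracket_phi[OF X(2,1), of "coef Z"] bracket_phi[OF Z(2,1), of "coef X"]
      bracket_phi[OF represents_phi[OF X(1)] X(1), of "coef Z"]
    show ?thesis
      by (simp add: mat_alg algebra_simps)
  qed
  ultimately show ?thesis
    unfolding lie_isomorphic_def
    by (intro exI[of _ ?f]) (simp add: lie_direct_sum_def so matrix_lie_def,
      simp add: so_lie_def phi_linear scaleR_diff_right)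
qed

end

section \<open>Dimension of subspaces with symmetries\<close>

text \<open>\<open>T\<close> splits \<open>V\<close> into its two eigenspaces, and the anticommuting
  \<open>U\<close> exchanges them.\<close>

lemma dim_fixed_space:
  fixes T U :: "real^'m^'m"
  assumes V: "subspace V" "\<And>v. v \<in> V \<Longrightarrow> T *v v \<in> V" "\<And>v. v \<in> V \<Longrightarrow> U *v v \<in> V"
    and TU: "T ** T = mat 1" "U ** U = mat 1" "T ** U = - (U ** T)"
  shows "dim V = 2 * dim {v \<in> V. T *v v = v}"
proof -
  let ?P = "{v \<in> V. T *v v = v}" and ?M = "{v \<in> V. T *v v = - v}"
  have TT: "T *v (T *v v) = v" and UU: "U *v (U *v v) = v" and TUv: "T *v (U *v v) = - (U *v (T *v v))" for v
    by (simp_all add: matrix_vector_mul_assoc TU matrix_vector_mult_minus_left)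
  have sub: "subspace ?P" "subspace ?M"
    using V(1) by (auto simp: subspace_def matrix_vector_right_distrib matrix_vector_mult_scaleR)
  have "?M = (\<lambda>v. U *v v) ` ?P"
  proof (intro equalityI subsetI)
    fix v assume v: "v \<in> ?M"
    then have "U *v v \<in> ?P" "v = U *v (U *v v)"
      using V by (simp_all add: TUv UU matrix_vector_mult_minus_right)
    then show "v \<in> (\<lambda>v. U *v v) ` ?P" by blast
  qed (use V in \<open>auto simp: TUv\<close>)
  moreover have "inj (\<lambda>v. U *v v)"
    by (metis UU injI)
  ultimately have dim: "dim ?M = dim ?P"
    by (simp add: dim_image_eq inj_on_subset)
  have "{x + y |x y. x \<in> ?P \<and> y \<in> ?M} = V"
  proof (intro equalityI subsetI)
    fix v assume v: "v \<in> V"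
    let ?x = "(1/2) *\<^sub>R (v + T *v v)" and ?y = "(1/2) *\<^sub>R (v - T *v v)"
    have "?x \<in> ?P" "?y \<in> ?M"
      using v V by (simp_all add: subspace_scale subspace_add subspace_diff matrix_vector_mult_scaleR
          matrix_vector_right_distrib matrix_vector_mult_diff_distrib TT add.commute scaleR_diff_right)
    moreover have "v = ?x + ?y"
      by (simp flip: scaleR_add_right)
    ultimately show "v \<in> {x + y |x y. x \<in> ?P \<and> y \<in> ?M}" by blast
  qed (use V(1) in \<open>auto intro: subspace_add\<close>)
  moreover have "?P \<inter> ?M = {0}"
    using V(1) by (auto simp: subspace_0 equal_neg_zero vec_eq_iff)
  ultimately show ?thesis
    using dim_sums_Int[OF sub] dim by simp
qed

text \<open>By induction on the dimension: split off the orbit of a unit vector and continue in its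
  orthogonal complement, which \<open>closed\<close> keeps invariant. Thus \<open>V\<close> is an
  orthogonal sum of blocks, each with an orbit of \<open>G\<close> as orthonormal basis.\<close>

lemma orthonormal_orbits:
  fixes G :: "(real^'m^'m) set" and V :: "(real^'m) set"
  assumes G: "finite G" "mat 1 \<in> G"
    and norm: "\<And>g x. g \<in> G \<Longrightarrow> (g *v x) \<bullet> (g *v x) = x \<bullet> x"
    and orth: "\<And>g h x. \<lbrakk>g \<in> G; h \<in> G; g \<noteq> h\<rbrakk> \<Longrightarrow> (g *v x) \<bullet> (h *v x) = 0"
    and closed: "\<And>g h. \<lbrakk>g \<in> G; h \<in> G\<rbrakk> \<Longrightarrow> \<exists>k\<in>G. \<exists>c. transpose g ** h = c *\<^sub>R k"
    and V: "subspace V" "\<And>g v. \<lbrakk>g \<in> G; v \<in> V\<rbrakk> \<Longrightarrow> g *v v \<in> V"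
  shows "\<exists>B. finite B \<and> (\<forall>b\<in>B. b \<bullet> b = 1) \<and>
    (\<forall>b\<in>B. \<forall>b'\<in>B. b \<noteq> b' \<longrightarrow> (\<forall>g\<in>G. \<forall>h\<in>G. (g *v b) \<bullet> (h *v b') = 0)) \<and>
    span ((\<lambda>(g, b). g *v b) ` (G \<times> B)) = V"
  using V
proof (induction "dim V" arbitrary: V rule: less_induct)
  case less
  let ?o = "\<lambda>B. (\<lambda>(g, b). g *v b) ` (G \<times> B)"
  show ?case
  proof (cases "V = {0}")
    case True
    then show ?thesis by (intro exI[of _ "{}"]) simp
  next
    case False
    then obtain u where u: "u \<in> V" "u \<noteq> 0"
      using subspace_0[OF less.prems(1)] by blast
    define v where "v = (1 / norm u) *\<^sub>R u"
    have v: "v \<in> V" "v \<bullet> v = 1"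
      using u less.prems(1) by (simp_all add: v_def subspace_scale dot_square_norm power2_eq_square)
    define V' where "V' = {x \<in> V. \<forall>g\<in>G. (g *v v) \<bullet> x = 0}"
    have sub: "subspace V'"
      using less.prems(1) by (auto simp: V'_def subspace_def inner_add_right)
    have inv: "h *v x \<in> V'" if h: "h \<in> G" and x: "x \<in> V'" for h x
    proof -
      have "(g *v v) \<bullet> (h *v x) = 0" if g: "g \<in> G" for g
      proof -
        obtain k c where k: "k \<in> G" "transpose h ** g = c *\<^sub>R k"
          using closed[OF h g] by blast
        have "(g *v v) \<bullet> (h *v x) = ((transpose h ** g) *v v) \<bullet> x"
          by (simp add: inner_mult_transpose inner_commute flip: matrix_vector_mul_assoc del: transpose_matrix_vector)
            (metis inner_commute inner_mult_transpose)
        then show ?thesis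
          using x k by (simp add: V'_def matrix_vector_mult_scaleR_left)
      qed
      then show ?thesis
        using x h less.prems(2) by (simp add: V'_def)
    qed
    have "v \<notin> V'"
      using v G(2) by (auto simp: V'_def intro!: bexI[of _ "mat 1"])
    then have "dim V' < dim V"
      using v(1) subspace_dim_equal[OF sub less.prems(1)] dim_subset[of V' V]
      by (force simp: V'_def)
    from less.hyps[OF this sub inv] obtain B where B: "finite B" "\<forall>b\<in>B. b \<bullet> b = 1"
      "\<forall>b\<in>B. \<forall>b'\<in>B. b \<noteq> b' \<longrightarrow> (\<forall>g\<in>G. \<forall>h\<in>G. (g *v b) \<bullet> (h *v b') = 0)"
      "span (?o B) = V'" by auto
    have BV: "g *v b \<in> V'" if "g \<in> G" "b \<in> B" for g b
      using that B(4) span_base[of "g *v b" "?o B"] by force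
    have span: "span (?o (insert v B)) = V"
    proof (rule span_subspace[OF _ _ less.prems(1)])
      show "?o (insert v B) \<subseteq> V"
        using less.prems(2) v BV by (auto simp: V'_def)
      show "V \<subseteq> span (?o (insert v B))"
      proof
        fix x assume x: "x \<in> V"
        \<comment> \<open>The orthogonal projection of \<open>x\<close> onto the span of the orbit
          of \<open>v\<close>.\<close>
        define y where "y = (\<Sum>g\<in>G. ((g *v v) \<bullet> x) *\<^sub>R (g *v v))"
        have y: "y \<in> span (?o (insert v B))"
          unfolding y_def by (intro span_sum span_scale span_base) auto
        have yV: "y \<in> V"
          unfolding y_def using less.prems v by (intro subspace_sum subspace_scale) auto
        have "(h *v v) \<bullet> (x - y) = 0" if h: "h \<in> G" for h
        proof -
          have "(h *v v) \<bullet> y = (\<Sum>g\<in>G. if g = h then (h *v v) \<bullet> x else 0)"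
            unfolding y_def inner_sum_right
            using h v by (intro sum.cong refl) (auto simp: norm orth)
          then show ?thesis
            using h G by (simp add: inner_diff_right)
        qed
        then have "x - y \<in> V'"
          using x yV less.prems(1) by (simp add: V'_def subspace_diff)
        then have "x - y \<in> span (?o (insert v B))"
          using B(4) span_mono[of "?o B" "?o (insert v B)"] by blast
        then show "x \<in> span (?o (insert v B))"
          using span_add[OF _ y] by fastforce
      qed
    qed
    have cross: "(g *v v) \<bullet> (h *v b) = 0" "(h *v b) \<bullet> (g *v v) = 0"
      if "g \<in> G" "h \<in> G" "b \<in> B" for g h b
      using BV[OF that(2,3)] that(1) by (simp_all add: V'_def inner_commute)
    have "(g *v b) \<bullet> (h *v b') = 0"
      if "b \<in> insert v B" "b' \<in> insert v B" "b \<noteq> b'" "g \<in> G" "h \<in> G" for b b' g h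
    proof (cases "b = v \<or> b' = v")
      case True
      with that cross show ?thesis by blast
    next
      case False
      with that B(3) show ?thesis by blast
    qed
    then have "\<forall>b\<in>insert v B. \<forall>b'\<in>insert v B. b \<noteq> b' \<longrightarrow> (\<forall>g\<in>G. \<forall>h\<in>G. (g *v b) \<bullet> (h *v b') = 0)"
      by blast
    moreover have "finite (insert v B)" "\<forall>b\<in>insert v B. b \<bullet> b = 1"
      using B(1,2) v(2) by simp_all
    ultimately show ?thesis
      using span by (intro exI[of _ "insert v B"] conjI)
  qed
qed

text \<open>The vectors \<open>g *v b\<close> are orthonormal, hence independent and distinct for
  distinct pairs. With \<open>orthonormal_orbits\<close> this makes \<open>card G\<close> a divisor
  of the dimension of an invariant subspace.\<close>

lemma orthonormal_orbits_card:
  fixes G :: "(real^'m^'m) set" and B V :: "(real^'m) set"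
  assumes G: "finite G"
    and norm: "\<And>g x. g \<in> G \<Longrightarrow> (g *v x) \<bullet> (g *v x) = x \<bullet> x"
    and orth: "\<And>g h x. \<lbrakk>g \<in> G; h \<in> G; g \<noteq> h\<rbrakk> \<Longrightarrow> (g *v x) \<bullet> (h *v x) = 0"
    and B: "finite B" "\<forall>b\<in>B. b \<bullet> b = 1"
      "\<forall>b\<in>B. \<forall>b'\<in>B. b \<noteq> b' \<longrightarrow> (\<forall>g\<in>G. \<forall>h\<in>G. (g *v b) \<bullet> (h *v b') = 0)"
  shows "dim ((\<lambda>(g, b). g *v b) ` (G \<times> B)) = card G * card B"
proof -
  let ?f = "\<lambda>(g, b). g *v b"
  have o: "?f x \<bullet> ?f y = (if x = y then 1 else 0)" if "x \<in> G \<times> B" "y \<in> G \<times> B" for x y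
  proof -
    obtain g b h b' where xy: "x = (g, b)" "y = (h, b')" by (metis surj_pair)
    show ?thesis
    proof (cases "b = b'")
      case True
      then show ?thesis using that xy norm orth B(2) by auto
    next
      case False
      then have "(g *v b) \<bullet> (h *v b') = 0" using that xy B(3) by blast
      then show ?thesis using False xy by simp
    qed
  qed
  have inj: "inj_on ?f (G \<times> B)"
    using o by (intro inj_onI) (metis zero_neq_one)
  have "pairwise orthogonal (?f ` (G \<times> B))"
    using o by (fastforce simp: pairwise_def orthogonal_def)
  moreover have "0 \<notin> ?f ` (G \<times> B)"
    using o by (metis (no_types, lifting) image_iff inner_zero_left zero_neq_one)
  ultimately have "independent (?f ` (G \<times> B))"
    by (rule pairwise_orthogonal_independent)
  then show ?thesis
    using dim_eq_card[OF refl, of "?f ` (G \<times> B)"] card_image[OF inj] by (simp add: card_cartesian_product)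
qed

section \<open>Divisibility of the dimension\<close>

lemma mat_one_neq_minus: "mat 1 \<noteq> - (mat 1 :: real^'m^'m)"
proof
  assume "mat 1 = - (mat 1 :: real^'m^'m)"
  then have "trace (mat 1 :: real^'m^'m) = trace (- (mat 1 :: real^'m^'m))"
    by (rule arg_cong)
  then show False
    unfolding trace_minus trace_I by simp
qed

text \<open>The identity, \<open>I\<close>, \<open>J\<close> and \<open>I ** J\<close> are
  quaternion units. A skew matrix sends each vector to an orthogonal one, so the orbits of the four
  units are orthogonal and \<open>V\<close> decomposes into blocks of dimension 4.\<close>

lemma four_dvd_dim:
  fixes I J :: "real^'m^'m" and V :: "(real^'m) set"
  assumes skew: "transpose I = - I" "transpose J = - J"
    and sq: "I ** I = - mat 1" "J ** J = - mat 1" and JI: "J ** I = - (I ** J)"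
    and V: "subspace V" "\<And>v. v \<in> V \<Longrightarrow> I *v v \<in> V" "\<And>v. v \<in> V \<Longrightarrow> J *v v \<in> V"
  shows "4 dvd dim V"
proof -
  define K where "K = I ** J"
  have sqI: "I ** (I ** A) = - A" and sqJ: "J ** (J ** A) = - A" and JIl: "J ** (I ** A) = - (I ** (J ** A))" for A :: "real^'m^'m"
    by (simp_all add: matrix_mul_assoc sq JI mat_minus_left)
  have tab: "I ** J = K" "J ** I = - K" "K ** K = - mat 1" "I ** K = - J" "K ** I = J" "J ** K = I" "K ** J = - I"
    by (simp_all add: K_def JI sq sqI sqJ JIl mat_minus_right flip: matrix_mul_assoc)
  have tK: "transpose K = - K"
    by (simp add: K_def matrix_transpose_mul skew mat_minus_left mat_minus_right JI)
  let ?G = "{mat 1, I, J, K}"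
  note one = mat_one_neq_minus[where 'm='m]
  have neq: "mat 1 \<noteq> I" "mat 1 \<noteq> J" "mat 1 \<noteq> K" "I \<noteq> J" "I \<noteq> K" "J \<noteq> K"
    using sq tab one by (metis matrix_mul_lid minus_minus)+
  have card: "card ?G = 4"
    using neq by simp
  have skew0: "x \<bullet> (A *v x) = 0" if "transpose A = - A" for A :: "real^'m^'m" and x
    using inner_mult_transpose[of A x x] unfolding that matrix_vector_mult_minus_left
    by (simp add: inner_commute)
  have fin: "finite ?G" "mat 1 \<in> ?G" by simp_all
  have inner: "(g *v x) \<bullet> (h *v x) = x \<bullet> ((transpose g ** h) *v x)" for g h :: "real^'m^'m" and x
    by (simp add: inner_mult_transpose flip: matrix_vector_mul_assoc del: transpose_matrix_vector)
  have nrm: "(g *v x) \<bullet> (g *v x) = x \<bullet> x" if "g \<in> ?G" for g x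
    using that unfolding inner by (auto simp: skew tK sq tab mat_minus_left)
  have orth: "(g *v x) \<bullet> (h *v x) = 0" if "g \<in> ?G" "h \<in> ?G" "g \<noteq> h" for g h x
    using that unfolding inner
    by (auto simp: skew tK sq tab mat_minus_left mat_minus_right skew0 matrix_vector_mult_minus_left)
  have closed: "\<exists>k\<in>?G. \<exists>c. transpose g ** h = c *\<^sub>R k" if "g \<in> ?G" "h \<in> ?G" for g h
  proof -
    have "transpose g ** h \<in> ?G \<union> uminus ` ?G"
      using that by (auto simp: skew tK sq tab mat_minus_left mat_minus_right)
    then show ?thesis
    proof
      assume "transpose g ** h \<in> ?G"
      then show ?thesis by (metis scaleR_one)
    next
      assume "transpose g ** h \<in> uminus ` ?G"
      then show ?thesis by (metis (no_types, lifting) image_iff scaleR_minus1_left)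
    qed
  qed
  have inv: "g *v v \<in> V" if "g \<in> ?G" "v \<in> V" for g v
    using that V by (auto simp: K_def simp flip: matrix_vector_mul_assoc)
  from orthonormal_orbits[OF fin nrm orth closed V(1) inv] obtain B where B: "finite B" "\<forall>b\<in>B. b \<bullet> b = 1"
      "\<forall>b\<in>B. \<forall>b'\<in>B. b \<noteq> b' \<longrightarrow> (\<forall>g\<in>?G. \<forall>h\<in>?G. (g *v b) \<bullet> (h *v b') = 0)"
      "span ((\<lambda>(g, b). g *v b) ` (?G \<times> B)) = V" by blast
  have "dim V = card ?G * card B"
    using orthonormal_orbits_card[OF fin(1) nrm orth B(1,2,3)] B(4) by (metis dim_span)
  then show ?thesis
    unfolding card by simp
qed

lemma two_dvd_card:
  fixes T U :: "real^'m^'m"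
  assumes "T ** T = mat 1" "U ** U = mat 1" "T ** U = - (U ** T)"
  shows "2 dvd CARD('m)"
  using dim_fixed_space[of UNIV T U] assms by simp

lemma fixed_space_invariant:
  fixes T A :: "real^'m^'m"
  assumes "T ** A = A ** T" "T *v v = v"
  shows "T *v (A *v v) = A *v v"
  using assms by (metis matrix_vector_mul_assoc)

lemma subspace_fixed: "subspace V \<Longrightarrow> subspace {v \<in> V. T *v v = v}"
  for T :: "real^'m^'m"
  by (auto simp: subspace_def matrix_vector_right_distrib matrix_vector_mult_scaleR)

text \<open>\<open>T'\<close> and \<open>U'\<close> commute with \<open>T\<close>, so the fixed
  space of \<open>T\<close> can be halved again.\<close>

lemma four_dvd_card:
  fixes T T' U U' :: "real^'m^'m"
  assumes "T ** T = mat 1" "U ** U = mat 1" "T ** U = - (U ** T)"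
    and "T' ** T' = mat 1" "U' ** U' = mat 1" "T' ** U' = - (U' ** T')"
    and "T ** T' = T' ** T" "T ** U' = U' ** T"
  shows "4 dvd CARD('m)"
proof -
  let ?V = "{v \<in> UNIV. T *v v = v}"
  have "CARD('m) = 2 * dim ?V"
    using dim_fixed_space[of UNIV T U] assms by simp
  moreover have "dim ?V = 2 * dim {v \<in> ?V. T' *v v = v}"
    using assms by (intro dim_fixed_space[where U = U'] subspace_fixed)
      (auto intro: fixed_space_invariant)
  ultimately show ?thesis by simp
qed

text \<open>The quaternion units act on the fixed space of \<open>T\<close>, which has half the
  dimension.\<close>

lemma eight_dvd_card:
  fixes T U I J :: "real^'m^'m"
  assumes "T ** T = mat 1" "U ** U = mat 1" "T ** U = - (U ** T)"
    and "transpose I = - I" "transpose J = - J"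
    and "I ** I = - mat 1" "J ** J = - mat 1" "J ** I = - (I ** J)"
    and "T ** I = I ** T" "T ** J = J ** T"
  shows "8 dvd CARD('m)"
proof -
  let ?V = "{v \<in> UNIV. T *v v = v}"
  have "CARD('m) = 2 * dim ?V"
    using dim_fixed_space[of UNIV T U] assms by simp
  moreover have "4 dvd dim ?V"
    using assms by (intro four_dvd_dim[of I J] subspace_fixed) (auto intro: fixed_space_invariant)
  ultimately show ?thesis by auto
qed

text \<open>Two halvings leave the common fixed space of \<open>T\<close> and \<open>T'\<close>, on
  which the quaternion units still act.\<close>

lemma sixteen_dvd_card:
  fixes T T' U U' I J :: "real^'m^'m"
  assumes "T ** T = mat 1" "U ** U = mat 1" "T ** U = - (U ** T)"
    and "T' ** T' = mat 1" "U' ** U' = mat 1" "T' ** U' = - (U' ** T')"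
    and "T ** T' = T' ** T" "T ** U' = U' ** T"
    and "transpose I = - I" "transpose J = - J"
    and "I ** I = - mat 1" "J ** J = - mat 1" "J ** I = - (I ** J)"
    and "T ** I = I ** T" "T ** J = J ** T" "T' ** I = I ** T'" "T' ** J = J ** T'"
  shows "16 dvd CARD('m)"
proof -
  let ?V = "{v \<in> UNIV. T *v v = v}"
  let ?W = "{v \<in> ?V. T' *v v = v}"
  have "CARD('m) = 2 * dim ?V"
    using dim_fixed_space[of UNIV T U] assms by simp
  moreover have "dim ?V = 2 * dim ?W"
    using assms by (intro dim_fixed_space[where U = U'] subspace_fixed)
      (auto intro: fixed_space_invariant)
  moreover have "4 dvd dim ?W"
    using assms by (intro four_dvd_dim[of I J] subspace_fixed) (auto intro: fixed_space_invariant)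
  ultimately show ?thesis by auto
qed

text \<open>
  Words in the generators are sorted by rewriting; the variants with a trailing \<open>X\<close> act inside a
  right-associated word.
\<close>

definition involution :: "real^'m^'m \<Rightarrow> bool" where
  "involution A \<longleftrightarrow> transpose A = A \<and> A ** A = mat 1"

lemma involutionD:
  assumes "involution A"
  shows "transpose A = A" "A ** A = mat 1" "A ** (A ** X) = (X :: real^'m^'m)"
  using assms by (simp_all add: involution_def matrix_mul_assoc)

definition anticommute :: "real^'m^'m \<Rightarrow> real^'m^'m \<Rightarrow> bool" where
  "anticommute A B \<longleftrightarrow> A ** B = - (B ** A)"

lemma anticommute_sort:
  assumes "anticommute A B"
  shows "B ** A = - (A ** B)" "B ** (A ** X) = - (A ** (B ** (X :: real^'m^'m)))"
  using assms by (simp_all add: anticommute_def matrix_mul_assoc mat_minus_left)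

lemma commute_sort:
  assumes "A ** B = B ** (A :: real^'m^'m)"
  shows "B ** A = A ** B" "B ** (A ** X) = A ** (B ** (X :: real^'m^'m))"
  using assms by (simp_all add: matrix_mul_assoc)

lemmas word_simps = mat_minus_left mat_minus_right matrix_transpose_mul matrix_mul_assoc[symmetric]

text \<open>The even words \<open>a ** b\<close> and \<open>a ** c\<close> are quaternion
  units.\<close>

lemma four_dvd_3:
  fixes a b c :: "real^'m^'m"
  assumes inv: "involution a" "involution b" "involution c"
    and anti: "anticommute a b" "anticommute a c" "anticommute b c"
  shows "4 dvd CARD('m)"
proof -
  note r = inv[THEN involutionD(1)] inv[THEN involutionD(2)] inv[THEN involutionD(3)]
    anti[THEN anticommute_sort(1)] anti[THEN anticommute_sort(2)]
  show ?thesis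
    using four_dvd_dim[of "a ** b" "a ** c" UNIV] by (simp add: word_simps r)
qed

text \<open>The word \<open>a ** b ** c ** d\<close> is an involution that anticommutes with
  \<open>a\<close> and commutes with the quaternion units \<open>a ** b\<close> and
  \<open>a ** c\<close>.\<close>

lemma eight_dvd_4:
  fixes a b c d :: "real^'m^'m"
  assumes inv: "involution a" "involution b" "involution c" "involution d"
    and anti: "anticommute a b" "anticommute a c" "anticommute a d"
      "anticommute b c" "anticommute b d" "anticommute c d"
  shows "8 dvd CARD('m)"
proof -
  note r = inv[THEN involutionD(1)] inv[THEN involutionD(2)] inv[THEN involutionD(3)]
    anti[THEN anticommute_sort(1)] anti[THEN anticommute_sort(2)]
  show ?thesis
    by (rule eight_dvd_card[of "a ** b ** c ** d" a "a ** b" "a ** c"]) (simp_all add: word_simps r)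
qed

text \<open>The words \<open>a ** b ** c ** d\<close> and \<open>a ** b ** e ** f\<close> are
  commuting involutions; \<open>a\<close> anticommutes with the first, \<open>e\<close> with the
  second only. The quaternion units \<open>a ** b\<close> and \<open>a ** c ** e\<close> commute
  with both words.\<close>

lemma sixteen_dvd_6:
  fixes a b c d :: "real^'m^'m"
  assumes inv: "involution a" "involution b" "involution c" "involution d" "involution e" "involution f"
    and anti: "anticommute a b" "anticommute a c" "anticommute a d" "anticommute a e" "anticommute a f"
      "anticommute b c" "anticommute b d" "anticommute b e" "anticommute b f"
      "anticommute c d" "anticommute c e" "anticommute c f"
      "anticommute d e" "anticommute d f" "anticommute e f"
  shows "16 dvd CARD('m)"
proof -
  note r = inv[THEN involutionD(1)] inv[THEN involutionD(2)] inv[THEN involutionD(3)]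
    anti[THEN anticommute_sort(1)] anti[THEN anticommute_sort(2)]
  show ?thesis
    by (rule sixteen_dvd_card[of "a ** b ** c ** d" a "a ** b ** e ** f" e "a ** b" "a ** c ** e"])
      (simp_all add: word_simps r)
qed

lemma eight_dvd_3_2:
  fixes a b c x y :: "real^'m^'m"
  assumes inv: "involution a" "involution b" "involution c" "involution x" "involution y"
    and anti: "anticommute a b" "anticommute a c" "anticommute b c" "anticommute x y"
    and comm: "a ** x = x ** a" "b ** x = x ** b" "c ** x = x ** c"
  shows "8 dvd CARD('m)"
proof -
  note r = inv[THEN involutionD(1)] inv[THEN involutionD(2)] inv[THEN involutionD(3)]
    anti[THEN anticommute_sort(1)] anti[THEN anticommute_sort(2)]
    comm[THEN commute_sort(1)] comm[THEN commute_sort(2)]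
  show ?thesis
    by (rule eight_dvd_card[of x y "a ** b" "a ** c"]) (simp_all add: word_simps r)
qed

text \<open>The commuting involutions are \<open>a ** b ** c ** d\<close> and \<open>x\<close>, with
  \<open>a\<close> and \<open>y\<close> exchanging their eigenspaces.\<close>

lemma sixteen_dvd_4_2:
  fixes a b c d x y :: "real^'m^'m"
  assumes inv: "involution a" "involution b" "involution c" "involution d" "involution x" "involution y"
    and anti: "anticommute a b" "anticommute a c" "anticommute a d"
      "anticommute b c" "anticommute b d" "anticommute c d" "anticommute x y"
    and comm: "a ** x = x ** a" "b ** x = x ** b" "c ** x = x ** c" "d ** x = x ** d"
      "a ** y = y ** a" "b ** y = y ** b" "c ** y = y ** c" "d ** y = y ** d"
  shows "16 dvd CARD('m)"
proof -
  note r = inv[THEN involutionD(1)] inv[THEN involutionD(2)] inv[THEN involutionD(3)]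
    anti[THEN anticommute_sort(1)] anti[THEN anticommute_sort(2)]
    comm[THEN commute_sort(1)] comm[THEN commute_sort(2)]
  show ?thesis
    by (rule sixteen_dvd_card[of "a ** b ** c ** d" a x y "a ** b" "a ** c"])
      (simp_all add: word_simps r)
qed

section \<open>Counting monomials\<close>

locale representation =
  fixes p q :: nat and \<rho> :: "cliff2 \<Rightarrow> real^'m^'m"
  assumes rep: "R_representation p q \<rho>" and symb: "symmetric_basis p q \<rho>"
begin

definition M :: "nat set \<Rightarrow> nat set \<Rightarrow> real^'m^'m" where
  "M A B = \<rho> (tensor (cl_mono A) (cl_mono B))"

lemma rep_mult: "x \<in> R_carrier p q \<Longrightarrow> y \<in> R_carrier p q \<Longrightarrow> \<rho> (R_mult p q x y) = \<rho> x ** \<rho> y"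
  and rep_add: "x \<in> R_carrier p q \<Longrightarrow> y \<in> R_carrier p q \<Longrightarrow> \<rho> (R_add x y) = \<rho> x + \<rho> y"
  and rep_scale: "x \<in> R_carrier p q \<Longrightarrow> \<rho> (R_scale c x) = c *\<^sub>R \<rho> x"
  and rep_one: "\<rho> R_one = mat 1"
  using rep by (auto simp: R_representation_def)

lemma M_mult:
  assumes "A \<subseteq> {1..p}" "A' \<subseteq> {1..p}" "B \<subseteq> {1..q}" "B' \<subseteq> {1..q}"
  shows "M A B ** M A' B' = (cl_sign A A' * cl_sign B B') *\<^sub>R M (sym_diff A A') (sym_diff B B')"
proof -
  have "sym_diff A A' \<subseteq> {1..p}" "sym_diff B B' \<subseteq> {1..q}"
    using assms by auto
  then show ?thesis
    unfolding M_def rep_mult[OF tensor_mono_carrier[OF assms(1,3)] tensor_mono_carrier[OF assms(2,4)], symmetric]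
      R_mult_mono[OF assms] by (intro rep_scale tensor_mono_carrier)
qed

lemma M_empty: "M {} {} = mat 1"
  using rep_one by (simp add: M_def R_one_def)

lemma M_gen:
  shows "i \<in> {1..p} \<Longrightarrow> M {i} {} = \<rho> (R_gen p i)"
    and "j \<in> {1..q} \<Longrightarrow> M {} {j} = \<rho> (R_gen p (p + j))"
  by (auto simp: M_def R_gen_def)

lemma M_gen_sym:
  shows "i \<in> {1..p} \<Longrightarrow> transpose (M {i} {}) = M {i} {}"
    and "j \<in> {1..q} \<Longrightarrow> transpose (M {} {j}) = M {} {j}"
  using symb by (auto simp: M_gen symmetric_basis_def)

lemma cl_sign_pm: "cl_sign A B = 1 \<or> cl_sign A B = -1"
  by (simp add: cl_sign_def minus_one_power_iff)

lemma cl_sign_sq [simp]: "cl_sign A B * cl_sign A B = 1"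
  using cl_sign_pm[of A B] by auto

lemma M_gen_sq:
  shows "i \<in> {1..p} \<Longrightarrow> M {i} {} ** M {i} {} = mat 1"
    and "j \<in> {1..q} \<Longrightarrow> M {} {j} ** M {} {j} = mat 1"
  by (simp_all add: M_mult M_empty cl_sign_simps)

lemma M_orthogonal:
  assumes "A \<subseteq> {1..p}" "B \<subseteq> {1..q}"
  shows "transpose (M A B) ** M A B = mat 1"
proof -
  have step: "transpose (U ** V) ** (U ** V) = mat 1"
    if "transpose U ** U = mat 1" "transpose V ** V = mat 1" for U V :: "real^'m^'m"
    using that by (simp add: matrix_transpose_mul) (metis matrix_mul_assoc matrix_mul_lid)
  have scale: "transpose (c *\<^sub>R U) ** (c *\<^sub>R U) = mat 1 \<Longrightarrow> c * c = 1 \<Longrightarrow> transpose U ** U = mat 1"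
    for c and U :: "real^'m^'m"
    by (simp add: transpose_scalar mat_scaleR_left mat_scaleR_right)
  have "finite A" "finite B"
    using assms finite_subset by blast+
  from \<open>finite A\<close> assms(1) have A: "transpose (M A {}) ** M A {} = mat 1"
  proof (induction A)
    case (insert a A)
    have d: "sym_diff {a} A = insert a A"
      using insert by auto
    have eq: "M {a} {} ** M A {} = cl_sign {a} A *\<^sub>R M (insert a A) {}"
      using M_mult[of "{a}" A "{}" "{}"] insert by (simp add: d cl_sign_simps del: insert_is_Un)
    have prod: "transpose (M {a} {} ** M A {}) ** (M {a} {} ** M A {}) = mat 1"
      using insert by (intro step) (simp_all add: M_gen_sq M_gen_sym)
    show ?case
      by (rule scale[OF prod[unfolded eq] cl_sign_sq])
  qed (simp add: M_empty)
  from \<open>finite B\<close> assms(2) show ?thesis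
  proof (induction B)
    case (insert b B)
    have d: "sym_diff {b} B = insert b B"
      using insert by auto
    have eq: "M {} {b} ** M A B = cl_sign {b} B *\<^sub>R M A (insert b B)"
      using M_mult[of "{}" A "{b}" B] insert assms by (simp add: d cl_sign_simps del: insert_is_Un)
    have prod: "transpose (M {} {b} ** M A B) ** (M {} {b} ** M A B) = mat 1"
      using insert by (intro step) (simp_all add: M_gen_sq M_gen_sym)
    show ?case
      by (rule scale[OF prod[unfolded eq] cl_sign_sq])
  qed (rule A)
qed

text \<open>The monomial squares to a sign and its transpose is its inverse, so the two agree up to
  that sign.\<close>

lemma M_transpose:
  assumes "A \<subseteq> {1..p}" "B \<subseteq> {1..q}"
  shows "transpose (M A B) = (cl_sign A A * cl_sign B B) *\<^sub>R M A B"
proof -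
  have "M A B ** M A B = (cl_sign A A * cl_sign B B) *\<^sub>R mat 1"
    using M_mult[OF assms(1,1,2,2)] by (simp add: M_empty)
  then have "transpose (M A B) ** (M A B ** M A B) = (cl_sign A A * cl_sign B B) *\<^sub>R transpose (M A B)"
    by (simp add: mat_scaleR_right)
  then have "M A B = (cl_sign A A * cl_sign B B) *\<^sub>R transpose (M A B)"
    by (simp add: matrix_mul_assoc M_orthogonal[OF assms])
  then have "(cl_sign A A * cl_sign B B) *\<^sub>R M A B =
      (cl_sign A A * cl_sign B B) *\<^sub>R ((cl_sign A A * cl_sign B B) *\<^sub>R transpose (M A B))"
    by (rule arg_cong)
  also have "\<dots> = transpose (M A B)"
    using cl_sign_pm[of A A] cl_sign_pm[of B B] by auto
  finally show ?thesis ..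
qed

section \<open>Traces of monomials\<close>

text \<open>The two signs count the elements of \<open>A\<close> below and above \<open>i\<close>;
  their product is the sign of moving the letter \<open>i\<close> past the word
  \<open>A\<close>.\<close>

lemma cl_sign_gen_swap:
  assumes "finite A"
  shows "cl_sign {i} A * cl_sign A {i} = (-1) ^ card (A - {i})"
proof -
  have "{(a, b). a \<in> {i} \<and> b \<in> A \<and> b < a} = (\<lambda>b. (i, b)) ` {b \<in> A. b < i}"
    "{(a, b). a \<in> A \<and> b \<in> {i} \<and> b < a} = (\<lambda>a. (a, i)) ` {a \<in> A. i < a}"
    by auto
  then have "cl_sign {i} A * cl_sign A {i} = (-1) ^ (card {b \<in> A. b < i} + card {a \<in> A. i < a})"
    by (simp add: cl_sign_def card_image inj_on_def power_add)
  also have "card {b \<in> A. b < i} + card {a \<in> A. i < a} = card ({b \<in> A. b < i} \<union> {a \<in> A. i < a})"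
    using assms by (intro card_Un_disjoint[symmetric]) auto
  also have "{b \<in> A. b < i} \<union> {a \<in> A. i < a} = A - {i}"
    by auto
  finally show ?thesis .
qed

text \<open>Conjugation by \<open>U\<close> preserves the trace but negates
  \<open>V\<close>.\<close>

lemma trace_anticommute:
  fixes U V :: "real^'m^'m"
  assumes "U ** U = mat 1" "U ** V = - (V ** U)"
  shows "trace V = 0"
proof -
  have "trace V = trace (U ** (U ** V))"
    by (simp add: matrix_mul_assoc assms(1))
  also have "\<dots> = - trace (U ** (V ** U))"
    unfolding assms(2) mat_minus_right trace_minus ..
  also have "trace (U ** (V ** U)) = trace V"
    by (subst trace_mul_sym) (simp add: assms(1) flip: matrix_mul_assoc)
  finally show ?thesis by simp
qed

lemma trace_M_gen:
  assumes A: "A \<subseteq> {1..p}" and B: "B \<subseteq> {1..q}"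
    and i: "i \<in> {1..p}" "odd (card (A - {i}))"
  shows "trace (M A B) = 0"
proof (rule trace_anticommute[of "M {i} {}"])
  have "finite A" using A finite_subset by blast
  then have s: "cl_sign {i} A = - cl_sign A {i}"
    using cl_sign_gen_swap[of A i] i(2) cl_sign_pm[of A "{i}"] cl_sign_pm[of "{i}" A] by auto
  have d: "sym_diff {i} A = sym_diff A {i}" by auto
  show "M {i} {} ** M A B = - (M A B ** M {i} {})"
    using i(1) by (simp add: M_mult[OF _ A _ B] M_mult[OF A _ B] cl_sign_simps s d
      Un_commute)
qed (use M_gen_sq i in simp)

lemma trace_M_gen':
  assumes A: "A \<subseteq> {1..p}" and B: "B \<subseteq> {1..q}"
    and i: "i \<in> {1..q}" "odd (card (B - {i}))"
  shows "trace (M A B) = 0"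
proof (rule trace_anticommute[of "M {} {i}"])
  have "finite B" using B finite_subset by blast
  then have s: "cl_sign {i} B = - cl_sign B {i}"
    using cl_sign_gen_swap[of B i] i(2) cl_sign_pm[of B "{i}"] cl_sign_pm[of "{i}" B] by auto
  show "M {} {i} ** M A B = - (M A B ** M {} {i})"
    using i(1) by (simp add: M_mult[OF _ A _ B] M_mult[OF A _ B] cl_sign_simps s
      Un_commute)
qed (use M_gen_sq i in simp)

text \<open>For odd \<open>card A\<close> an index outside \<open>A\<close> serves, for even
  \<open>card A\<close> an index inside. The excluded full set of odd size is the volume element,
  which commutes with all generators.\<close>

lemma odd_card_Diff_ex:
  fixes A I :: "nat set"
  assumes "finite I" "A \<subseteq> I" "A \<noteq> {}" "\<not> (A = I \<and> odd (card I))"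
  obtains i where "i \<in> I" "odd (card (A - {i}))"
proof (cases "odd (card A)")
  case True
  with assms have "A \<subset> I" by blast
  then obtain i where "i \<in> I" "i \<notin> A"
    using psubset_imp_ex_mem by blast
  then show ?thesis using True by (intro that[of i]) simp_all
next
  case False
  obtain i where i: "i \<in> A" using assms by blast
  have "finite A" using assms finite_subset by blast
  then have "card A = Suc (card (A - {i}))"
    using i by (metis card_Suc_Diff1)
  with False have "odd (card (A - {i}))"
    by (metis even_Suc)
  moreover have "i \<in> I" using i assms(2) by blast
  ultimately show ?thesis by (rule that[rotated])
qed

text \<open>Each unordered pair of letters contributes one sign; the value is the square of the
  volume element.\<close>

lemma cl_sign_interval: "cl_sign {1..r} {1..r} = (-1) ^ (r * (r - 1) div 2)"
proof -
  have "card {(a, b). a \<in> {1..r} \<and> b \<in> {1..r} \<and> b < a} = r * (r - 1) div 2" for r :: nat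
  proof (induction r)
    case (Suc r)
    let ?P = "\<lambda>r. {(a, b). a \<in> {1..r} \<and> b \<in> {1..r} \<and> b < a}"
    have "?P (Suc r) = ?P r \<union> {Suc r} \<times> {1..r}"
      by auto
    moreover have "finite (?P r)"
      by (rule finite_subset[of _ "{1..r} \<times> {1..r}"]) auto
    then have "card (?P r \<union> {Suc r} \<times> {1..r}) = card (?P r) + card ({Suc r} \<times> {1..r})"
      by (rule card_Un_disjoint) auto
    ultimately have "card (?P (Suc r)) = r * (r - 1) div 2 + r"
      using Suc by (simp add: card_cartesian_product)
    also have "\<dots> = Suc r * (Suc r - 1) div 2"
      by (cases r) (auto simp: algebra_simps)
    finally show ?case .
  qed simp
  then show ?thesis by (simp add: cl_sign_def)
qed

text \<open>A monomial anticommuting with some generator has trace 0. By \<open>rs\<close> at most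
  one of \<open>r\<close> and \<open>s\<close> is odd, so the only other candidate is a single
  volume element; its rank is 3 modulo 4, so it squares to -1 and is skew.\<close>

lemma trace_M:
  assumes A: "A \<subseteq> {1..r}" "r \<le> p" and B: "B \<subseteq> {1..s}" "s \<le> q" and ne: "A \<noteq> {} \<or> B \<noteq> {}"
    and rs: "(even r \<or> r mod 4 = 3) \<and> even s \<or> even r \<and> (even s \<or> s mod 4 = 3)"
  shows "trace (M A B) = 0"
proof (rule ccontr)
  assume nz: "trace (M A B) \<noteq> 0"
  have Ap: "A \<subseteq> {1..p}" and Bq: "B \<subseteq> {1..q}" using A B by auto
  have 1: "A = {} \<or> A = {1..r} \<and> odd r"
  proof (rule ccontr)
    assume "\<not> ?thesis"
    then obtain i where "i \<in> {1..r}" "odd (card (A - {i}))"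
      using odd_card_Diff_ex[of "{1..r}" A] A by auto
    then show False using trace_M_gen[OF Ap Bq, of i] nz A(2) by auto
  qed
  have 2: "B = {} \<or> B = {1..s} \<and> odd s"
  proof (rule ccontr)
    assume "\<not> ?thesis"
    then obtain i where "i \<in> {1..s}" "odd (card (B - {i}))"
      using odd_card_Diff_ex[of "{1..s}" B] B by auto
    then show False using trace_M_gen'[OF Ap Bq, of i] nz B(2) by auto
  qed
  have sg: "cl_sign {1..n} {1..n} = -1" if "n mod 4 = 3" for n
  proof -
    define k where "k = n div 4"
    have "n = 4 * k + 3" using that by (simp add: k_def) presburger
    then have "n * (n - 1) div 2 = 2 * (4 * k * k + 5 * k + 1) + 1"
      by (simp add: algebra_simps)
    then show ?thesis unfolding cl_sign_interval by simp
  qed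
  have "cl_sign A A * cl_sign B B = -1"
    using 1 2 ne rs by (auto simp: sg cl_sign_simps simp del: One_nat_def)
  then have "transpose (M A B) = - M A B"
    using M_transpose[OF Ap Bq] by simp
  then have "trace (M A B) = - trace (M A B)"
    by (metis trace_minus trace_transpose)
  with nz show False by simp
qed

text \<open>Up to sign a product of two monomials is a monomial, so \<open>trace_M\<close> makes the
  \<open>2 ^ (r + s)\<close> monomials orthogonal in the space of all matrices. Taking
  \<open>r\<close> and \<open>s\<close> below \<open>p\<close> and \<open>q\<close> drops generators
  in order to meet \<open>rs\<close>.\<close>

lemma card_ge:
  assumes "r \<le> p" "s \<le> q"
    and rs: "(even r \<or> r mod 4 = 3) \<and> even s \<or> even r \<and> (even s \<or> s mod 4 = 3)"
  shows "2 ^ (r + s) \<le> (CARD('m))\<^sup>2"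
proof -
  let ?I = "Pow {1..r} \<times> Pow {1..s}"
  let ?f = "\<lambda>(A, B). M A B"
  have ip: "M A B \<bullet> M A' B' = (if (A, B) = (A', B') then real CARD('m) else 0)"
    if "A \<subseteq> {1..r}" "B \<subseteq> {1..s}" "A' \<subseteq> {1..r}" "B' \<subseteq> {1..s}" for A B A' B'
  proof -
    have sub: "A \<subseteq> {1..p}" "A' \<subseteq> {1..p}" "B \<subseteq> {1..q}" "B' \<subseteq> {1..q}"
      using that assms by auto
    show ?thesis
    proof (cases "(A, B) = (A', B')")
      case True
      then show ?thesis using M_orthogonal[OF sub(1,3)] by (simp add: inner_mat trace_I)
    next
      case False
      then have "trace (M (sym_diff A A') (sym_diff B B')) = 0"
        using that assms by (intro trace_M[of _ r _ s]) auto
      then show ?thesis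
        using False by (auto simp: inner_mat M_transpose[OF sub(1,3)] mat_scaleR_left trace_scaleR M_mult[OF sub])
    qed
  qed
  have pos: "real CARD('m) \<noteq> 0" by simp
  have inj: "inj_on ?f ?I"
  proof (intro inj_onI)
    fix x y assume xy: "x \<in> ?I" "y \<in> ?I" "?f x = ?f y"
    obtain A B A' B' where e: "x = (A, B)" "y = (A', B')" by (metis surj_pair)
    show "x = y"
      using xy ip[of A B A' B'] ip[of A' B' A' B'] pos unfolding e by (auto split: if_splits)
  qed
  have "pairwise orthogonal (?f ` ?I)"
    unfolding pairwise_def orthogonal_def using ip by fastforce
  moreover have "0 \<notin> ?f ` ?I"
  proof
    assume "0 \<in> ?f ` ?I"
    then obtain A B where "A \<subseteq> {1..r}" "B \<subseteq> {1..s}" "M A B = 0" by auto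
    with ip[of A B A B] show False by simp
  qed
  ultimately have "independent (?f ` ?I)"
    by (rule pairwise_orthogonal_independent)
  then have "card (?f ` ?I) \<le> DIM(real^'m^'m)"
    by (rule independent_card_le)
  also have "card (?f ` ?I) = 2 ^ (r + s)"
    unfolding card_image[OF inj] by (simp add: card_cartesian_product card_Pow power_add)
  finally show ?thesis by (simp add: power2_eq_square)
qed

section \<open>The generators of a representation\<close>

abbreviation "S \<equiv> \<lambda>i. \<rho> (R_gen p i)"

sublocale clifford_system p q S
proof
  fix i assume i: "i \<in> {1..p+q}"
  show "transpose (S i) = S i"
    using symb i by (simp add: symmetric_basis_def)
  show "S i ** S i = mat 1"
    using rep_mult[OF R_gen_carrier[OF i] R_gen_carrier[OF i]] R_gen_square[OF i] rep_one by simp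
next
  fix i j assume i: "i \<in> {1..p+q}" and j: "j \<in> {1..p+q}" and "i \<noteq> j"
  note mult = rep_mult[OF R_gen_carrier[OF i] R_gen_carrier[OF j]]
    rep_mult[OF R_gen_carrier[OF j] R_gen_carrier[OF i]]
  show "S i ** S j = (- sgn_pq p i * sgn_pq p j) *\<^sub>R (S j ** S i)"
  proof (cases "i \<le> p \<longleftrightarrow> j \<le> p")
    case True
    from R_gen_anticommute[OF i j \<open>i \<noteq> j\<close> True]
    have "S i ** S j = \<rho> (R_scale (-1) (R_mult p q (R_gen p j) (R_gen p i)))"
      unfolding mult[symmetric] by simp
    also have "\<dots> = (-1) *\<^sub>R (S j ** S i)"
      unfolding mult[symmetric] by (rule rep_scale[OF R_mult_closed])
    finally show ?thesis
      using True by (auto simp: sgn_pq_def)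
  next
    case False
    then have "R_mult p q (R_gen p i) (R_gen p j) = R_mult p q (R_gen p j) (R_gen p i)"
      using R_gen_commute[of i p j q] R_gen_commute[of j p i q] i j by auto
    then show ?thesis
      using mult False by (auto simp: sgn_pq_def)
  qed
qed

lemma g_lie_eq: "g_lie p q \<rho> = matrix_lie g_set"
  by (simp add: g_lie_def g_set_def act_def Let_def)

lemma h_lie_eq: "h_lie p q \<rho> = matrix_lie h_set"
  by (simp add: h_lie_def h_set_def act_def Let_def)

text \<open>Generators of the same factor anticommute. For one generator from each factor, a third
  one anticommutes with exactly one of them and hence with the product; it exists because
  \<open>p + q \<noteq> 2\<close>.\<close>

lemma trace_pair:
  assumes "p + q \<noteq> 2" and i: "i \<in> idx" and j: "j \<in> idx" and "i \<noteq> j"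
  shows "trace (S i ** S j) = 0"
proof (cases "\<epsilon> i = \<epsilon> j")
  case True
  then have "trace (S i ** S j) = - trace (S j ** S i)"
    using swap[OF i j \<open>i \<noteq> j\<close>] by (simp add: trace_minus)
  then show ?thesis
    using trace_mul_sym[of "S i" "S j"] by simp
next
  case False
  have "\<not> idx \<subseteq> {i, j}"
  proof
    assume "idx \<subseteq> {i, j}"
    then have "card idx \<le> 2"
      using card_mono[of "{i, j}" idx] \<open>i \<noteq> j\<close> by simp
    moreover have "card {i, j} \<le> card idx"
      using i j by (intro card_mono) auto
    ultimately show False
      using assms \<open>i \<noteq> j\<close> by simp
  qed
  then obtain k where k: "k \<in> idx" "k \<noteq> i" "k \<noteq> j" by blast
  have "S k ** (S i ** S j) = (\<epsilon> i * \<epsilon> j) *\<^sub>R ((S i ** S j) ** S k)"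
    using swap[OF k(1) i k(2)] swap[OF k(1) j k(3)]
    by (simp add: matrix_mul_assoc mat_alg) (simp add: mat_alg mult_ac flip: matrix_mul_assoc)
  moreover have "\<epsilon> i * \<epsilon> j = -1"
    using False by (auto simp: sgn_pq_def split: if_splits)
  ultimately show ?thesis
    using square[OF k(1)] by (intro trace_anticommute[of "S k"]) simp_all
qed

lemma independent_gens:
  assumes "p + q \<noteq> 2" and sum: "(\<Sum>i\<in>idx. a i *\<^sub>R S i) = 0" and k: "k \<in> idx"
  shows "a k = 0"
proof -
  have "0 = trace ((\<Sum>i\<in>idx. a i *\<^sub>R S i) ** S k)"
    unfolding sum by (simp add: mat_zero_left trace_zero)
  also have "\<dots> = (\<Sum>i\<in>idx. a i * trace (S i ** S k))"
    by (simp add: mat_alg trace_alg)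
  also have "\<dots> = (\<Sum>i\<in>idx. if i = k then a i * real CARD('m) else 0)"
    using k trace_pair[OF assms(1)] by (intro sum.cong refl) (simp add: square trace_I)
  finally show ?thesis using k by simp
qed

section \<open>Lower bounds for the dimension\<close>

definition gen :: "bool \<Rightarrow> nat \<Rightarrow> real^'m^'m" where
  "gen t i = S (if t then i else p + i)"

text \<open>The Boolean selects one of the two tensor factors, so that a statement for all
  \<open>t\<close> covers the exchange of \<open>p\<close> and \<open>q\<close>.\<close>

definition len :: "bool \<Rightarrow> nat" where
  "len t = (if t then p else q)"

lemma gen_involution: "1 \<le> i \<Longrightarrow> i \<le> len t \<Longrightarrow> involution (gen t i)"
  using sym square by (auto simp: involution_def gen_def len_def)

lemma gen_anticommute:
  assumes "1 \<le> i" "i \<le> len t" "1 \<le> j" "j \<le> len t" "i \<noteq> j"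
  shows "anticommute (gen t i) (gen t j)"
  using assms swap[of "if t then i else p + i" "if t then j else p + j"]
  by (auto simp: anticommute_def gen_def len_def sgn_pq_def)

lemma gen_commute:
  assumes "1 \<le> i" "i \<le> len t" "1 \<le> j" "j \<le> len (\<not> t)"
  shows "gen t i ** gen (\<not> t) j = gen (\<not> t) j ** gen t i"
  using assms swap[of "if t then i else p + i" "if t then p + j else j"]
  by (auto simp: gen_def len_def sgn_pq_def)

lemma dvd_card:
  shows "2 \<le> len t \<Longrightarrow> 2 dvd CARD('m)"
    and "2 \<le> len t \<Longrightarrow> 2 \<le> len (\<not> t) \<Longrightarrow> 4 dvd CARD('m)"
    and "3 \<le> len t \<Longrightarrow> 4 dvd CARD('m)"
    and "4 \<le> len t \<Longrightarrow> 8 dvd CARD('m)"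
    and "3 \<le> len t \<Longrightarrow> 2 \<le> len (\<not> t) \<Longrightarrow> 8 dvd CARD('m)"
    and "6 \<le> len t \<Longrightarrow> 16 dvd CARD('m)"
    and "4 \<le> len t \<Longrightarrow> 2 \<le> len (\<not> t) \<Longrightarrow> 16 dvd CARD('m)"
proof -
  let ?s = "\<not> t"
  note g = gen_involution gen_anticommute gen_commute
  show "2 dvd CARD('m)" if "2 \<le> len t"
    using that gen_involution[of 1 t] gen_involution[of 2 t] gen_anticommute[of 1 t 2]
    by (intro two_dvd_card[of "gen t 1" "gen t 2"]) (simp_all add: involution_def anticommute_def)
  show "4 dvd CARD('m)" if "2 \<le> len t" "2 \<le> len ?s"
    using that gen_involution[of 1 t] gen_involution[of 2 t] gen_anticommute[of 1 t 2]
      gen_involution[of 1 ?s] gen_involution[of 2 ?s] gen_anticommute[of 1 ?s 2]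
      gen_commute[of 1 t 1] gen_commute[of 1 t 2]
    by (intro four_dvd_card[of "gen t 1" "gen t 2" "gen ?s 1" "gen ?s 2"])
      (simp_all add: involution_def anticommute_def)
  show "4 dvd CARD('m)" if "3 \<le> len t"
    using that by (intro four_dvd_3[of "gen t 1" "gen t 2" "gen t 3"] g) simp_all
  show "8 dvd CARD('m)" if "4 \<le> len t"
    using that by (intro eight_dvd_4[of "gen t 1" "gen t 2" "gen t 3" "gen t 4"] g) simp_all
  show "8 dvd CARD('m)" if "3 \<le> len t" "2 \<le> len ?s"
    using that by (intro eight_dvd_3_2[of "gen t 1" "gen t 2" "gen t 3" "gen ?s 1" "gen ?s 2"] g) simp_all
  show "16 dvd CARD('m)" if "6 \<le> len t"
    using that by (intro sixteen_dvd_6[of "gen t 1" "gen t 2" "gen t 3" "gen t 4" "gen t 5" "gen t 6"] g) simp_all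
  show "16 dvd CARD('m)" if "4 \<le> len t" "2 \<le> len ?s"
    using that by (intro sixteen_dvd_4_2[of "gen t 1" "gen t 2" "gen t 3" "gen t 4" "gen ?s 1" "gen ?s 2"] g) simp_all
qed

text \<open>For \<open>k = p + q - 2\<close> this turns the count of monomials into
  \<open>4 * k < CARD('m)\<close>. The base case compares 1936 with 2048.\<close>

lemma power_gt_16_square: "11 \<le> k \<Longrightarrow> 16 * k\<^sup>2 < 2 ^ k" for k :: nat
proof (induction k rule: dec_induct)
  case (step k)
  have "16 * (Suc k)\<^sup>2 \<le> 2 * (16 * k\<^sup>2)"
  proof -
    have "2 * k + 1 \<le> k * k"
      using step(1) mult_le_mono1[OF step(1), of k] by linarith
    then show ?thesis by (simp add: power2_eq_square algebra_simps)
  qed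
  then show ?case using step by simp
qed simp

text \<open>Divisibility suffices up to \<open>p + q = 10\<close> and counting from 12 on; the value
  11 uses both.\<close>

lemma card_large:
  assumes "p + q \<ge> 1" "p + q \<noteq> 2"
    and "\<not> (p + q = 3 \<and> CARD('m) \<in> {2, 4})"
    and "\<not> (p + q = 4 \<and> CARD('m) \<in> {4, 8})"
    and "\<not> (p + q = 5 \<and> CARD('m) = 8)"
    and "\<not> (p + q = 6 \<and> CARD('m) \<in> {8, 16})"
    and "\<not> (p + q = 7 \<and> CARD('m) = 16)"
    and "\<not> (p + q = 8 \<and> CARD('m) = 16)"
    and "\<not> (p + q = 9 \<and> CARD('m) = 16)"
    and "\<not> (p + q = 10 \<and> CARD('m) \<in> {16, 32})"
    and "\<not> (p + q = 11 \<and> CARD('m) = 32)"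
  shows "4 * (p + q) < CARD('m) + 8"
proof -
  have m0: "CARD('m) > 0" by simp
  have d2: "2 dvd CARD('m)" if "p + q \<ge> 3"
    using dvd_card(1)[of True] dvd_card(1)[of False] that by (fastforce simp: len_def)
  have d4: "4 dvd CARD('m)" if "p + q \<ge> 4"
    using dvd_card(2)[of True] dvd_card(3)[of True] dvd_card(3)[of False] that by (fastforce simp: len_def)
  have d8: "8 dvd CARD('m)" if "p + q \<ge> 5"
  proof -
    have "4 \<le> p \<or> 4 \<le> q \<or> 3 \<le> p \<and> 2 \<le> q \<or> 3 \<le> q \<and> 2 \<le> p" using that by linarith
    then show ?thesis
      using dvd_card(4,5)[of True] dvd_card(4,5)[of False] by (auto simp: len_def)
  qed
  have d16: "16 dvd CARD('m)" if "p + q \<ge> 7"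
  proof -
    have "6 \<le> p \<or> 6 \<le> q \<or> 4 \<le> p \<and> 2 \<le> q \<or> 4 \<le> q \<and> 2 \<le> p" using that by linarith
    then show ?thesis
      using dvd_card(6,7)[of True] dvd_card(6,7)[of False] by (auto simp: len_def)
  qed
  have count: "2 ^ k \<le> (CARD('m))\<^sup>2" if "k \<le> r + s" "r \<le> p" "s \<le> q"
    "(even r \<or> r mod 4 = 3) \<and> even s \<or> even r \<and> (even s \<or> s mod 4 = 3)" for k r s
    by (rule order_trans[OF power_increasing[OF that(1)] card_ge[OF that(2-4)]]) simp
  have even: "even (a - a mod 2)" for a :: nat by presburger
  \<comment> \<open>Rounding \<open>p\<close> and \<open>q\<close> down to even numbers loses at
    most two generators.\<close>
  have "p + q - 2 \<le> p - x + (q - y)" if "x < 2" "y < 2" for x y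
    using that by linarith
  then have halves: "p + q - 2 \<le> p - p mod 2 + (q - q mod 2)"
    by simp
  have "p + q = 1 \<or> p + q = 3 \<or> p + q = 4 \<or> p + q = 5 \<or> p + q = 6 \<or> p + q = 7 \<or>
      p + q = 8 \<or> p + q = 9 \<or> p + q = 10 \<or> p + q = 11 \<or> p + q = 12 \<or> p + q \<ge> 13"
    using assms(1,2) by presburger
  then consider "p + q = 1" | "p + q = 3" | "p + q = 4" | "p + q = 5" | "p + q = 6" | "p + q = 7"
    | "p + q = 8" | "p + q = 9" | "p + q = 10" | "p + q = 11" | "p + q = 12" | "p + q \<ge> 13"
    by blast
  then show ?thesis
  proof cases
    case 10
    \<comment> \<open>Here \<open>p + q = 11\<close>, so exactly one of \<open>p\<close> and
      \<open>q\<close> is odd and rounding loses just one generator.\<close>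
    have "10 \<le> p - p mod 2 + (q - q mod 2)" using 10 by presburger
    then have "2 ^ 10 \<le> (CARD('m))\<^sup>2"
      by (intro count[of 10 "p - p mod 2" "q - q mod 2"]) (use even in \<open>simp_all\<close>)
    then have "32 \<le> CARD('m)"
      using power2_le_imp_le[of 32 "CARD('m)"] by simp
    moreover have "16 dvd CARD('m)" using d16 10 by simp
    ultimately have "48 \<le> CARD('m)" using assms(11) 10 by presburger
    then show ?thesis using 10 by simp
  next
    case 11
    have "2 ^ 11 \<le> (CARD('m))\<^sup>2"
    \<comment> \<open>Here \<open>p + q = 12\<close>. If both numbers are odd, one of them is 3
      modulo 4 and is kept in full, so just one generator is lost; losing two would only give
      dimension at least 32.\<close>
    proof (cases "even p")
      case True
      then have "even q" using 11 by presburger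
      then show ?thesis using True 11 by (intro count[of 11 p q]) auto
    next
      case False
      show ?thesis
      proof (cases "p mod 4 = 3")
        case True
        moreover have "even (q - 1)" "11 \<le> p + (q - 1)" using 11 False by presburger+
        ultimately show ?thesis by (intro count[of 11 p "q - 1"]) simp_all
      next
        case p: False
        have "q mod 4 = 3" "even (p - 1)" "11 \<le> p - 1 + q" using p False 11 by presburger+
        then show ?thesis by (intro count[of 11 "p - 1" q]) simp_all
      qed
    qed
    then have "40 < CARD('m)"
      using power_mono[of "CARD('m)" 40 2] by (cases "40 < CARD('m)") auto
    then show ?thesis using 11 by simp
  next
    case 12
    define k where "k = p + q - 2"
    have "2 ^ k \<le> (CARD('m))\<^sup>2"
      unfolding k_def
      by (intro count[of _ "p - p mod 2" "q - q mod 2"]) (use even halves in \<open>simp_all\<close>)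
    moreover have "16 * k\<^sup>2 < 2 ^ k"
      using 12 by (intro power_gt_16_square) (simp add: k_def)
    ultimately have "(4 * k)\<^sup>2 < (CARD('m))\<^sup>2"
      by (simp add: power_mult_distrib)
    then have "4 * k < CARD('m)"
      by (rule power2_less_imp_less) simp
    then show ?thesis using 12 by (simp add: k_def)
  next
    \<comment> \<open>From here to \<open>p + q = 10\<close> the excluded dimensions are exactly the
      positive multiples with \<open>CARD('m) + 8 \<le> 4 * (p + q)\<close>.\<close>
    case 2
    then obtain k where k: "CARD('m) = 2 * k" using d2 by (auto elim: dvdE)
    then have "k \<noteq> 0" "k \<noteq> 1" "k \<noteq> 2" using 2 assms(3) m0 by auto
    then show ?thesis using 2 k by simp
  next
    case 3
    then obtain k where k: "CARD('m) = 4 * k" using d4 by (auto elim: dvdE)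
    then have "k \<noteq> 0" "k \<noteq> 1" "k \<noteq> 2" using 3 assms(4) m0 by auto
    then show ?thesis using 3 k by simp
  next
    case 4
    then obtain k where k: "CARD('m) = 8 * k" using d8 by (auto elim: dvdE)
    then have "k \<noteq> 0" "k \<noteq> 1" using 4 assms(5) m0 by auto
    then show ?thesis using 4 k by simp
  next
    case 5
    then obtain k where k: "CARD('m) = 8 * k" using d8 by (auto elim: dvdE)
    then have "k \<noteq> 0" "k \<noteq> 1" "k \<noteq> 2" using 5 assms(6) m0 by auto
    then show ?thesis using 5 k by simp
  next
    case 6
    then obtain k where k: "CARD('m) = 16 * k" using d16 by (auto elim: dvdE)
    then have "k \<noteq> 0" "k \<noteq> 1" using 6 assms(7) m0 by auto
    then show ?thesis using 6 k by simp
  next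
    case 7
    then obtain k where k: "CARD('m) = 16 * k" using d16 by (auto elim: dvdE)
    then have "k \<noteq> 0" "k \<noteq> 1" using 7 assms(8) m0 by auto
    then show ?thesis using 7 k by simp
  next
    case 8
    then obtain k where k: "CARD('m) = 16 * k" using d16 by (auto elim: dvdE)
    then have "k \<noteq> 0" "k \<noteq> 1" using 8 assms(9) m0 by auto
    then show ?thesis using 8 k by simp
  next
    case 9
    then obtain k where k: "CARD('m) = 16 * k" using d16 by (auto elim: dvdE)
    then have "k \<noteq> 0" "k \<noteq> 1" "k \<noteq> 2" using 9 assms(10) m0 by auto
    then show ?thesis using 9 k by simp
  qed simp
qed


section \<open>Two generators\<close>

text \<open>Every nonzero vector generates a subrepresentation spanned by its orbit, of dimension
  \<open>card G\<close>. Such subrepresentations are therefore irreducible, matching orbits makes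
  them equivalent, and \<open>orthonormal_orbits\<close> splits the whole space into them.\<close>

lemma pure_orbits:
  assumes G: "finite G" "mat 1 \<in> G"
    and norm: "\<And>g x. g \<in> G \<Longrightarrow> (g *v x) \<bullet> (g *v x) = x \<bullet> x"
    and orth: "\<And>g h x. \<lbrakk>g \<in> G; h \<in> G; g \<noteq> h\<rbrakk> \<Longrightarrow> (g *v x) \<bullet> (h *v x) = 0"
    and closed: "\<And>g h. \<lbrakk>g \<in> G; h \<in> G\<rbrakk> \<Longrightarrow> \<exists>k\<in>G. \<exists>c. transpose g ** h = c *\<^sub>R k"
    and image: "G \<subseteq> \<rho> ` R_plus p q" "\<rho> ` R_plus p q \<subseteq> span G"
  shows "pure p q \<rho>"
proof -
  obtain B :: "(real^'m) set" where B: "finite B" "\<forall>b\<in>B. b \<bullet> b = 1"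
    "\<forall>b\<in>B. \<forall>b'\<in>B. b \<noteq> b' \<longrightarrow> (\<forall>g\<in>G. \<forall>h\<in>G. (g *v b) \<bullet> (h *v b') = 0)"
    "span ((\<lambda>(g, b). g *v b) ` (G \<times> B)) = UNIV"
    using orthonormal_orbits[OF G norm orth closed subspace_UNIV UNIV_I] by blast
  define U where "U b = span ((\<lambda>g. g *v b) ` G)" for b :: "real^'m"
  have span_G: "C *v x \<in> V" if "C \<in> span G" "subspace V" "\<And>g. g \<in> G \<Longrightarrow> g *v x \<in> V" for C x V
    using that(1)
  proof (induction rule: span_induct)
    case base
    show ?case
      using that(2) by (auto simp: subspace_def matrix_vector_mult_add_rdistrib matrix_vector_mult_scaleR_left)
  qed (rule that(3))
  have mult_G: "C ** g \<in> span G" if C: "C \<in> span G" and g: "g \<in> G" for C g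
    using C
  proof (induction rule: span_induct)
    case base
    show ?case
      by (auto simp: subspace_def mat_alg span_0 span_add span_scale)
  next
    case (step h)
    obtain x y where "x \<in> R_plus p q" "y \<in> R_plus p q" "h = \<rho> x" "g = \<rho> y"
      using image(1) step g by blast
    then have "h ** g = \<rho> (R_mult p q x y)" "R_mult p q x y \<in> R_plus p q"
      by (simp_all add: rep_mult R_plus_carrier R_plus.mult)
    then show ?case using image(2) by auto
  qed
  have G_mem: "g *v b \<in> U b" if "g \<in> G" for g b
    using that by (auto simp: U_def intro: span_base)
  have sub_U: "subspace (U b)" for b
    by (simp add: U_def)
  have span_U: "C *v b \<in> U b" if "C \<in> span G" for C b
    using that sub_U G_mem by (rule span_G)
  have U_inv: "C *v u \<in> U b" if "C \<in> span G" "u \<in> U b" for C u b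
    using that(2) unfolding U_def[of b]
  proof (induction rule: span_induct)
    case base
    show ?case
      using sub_U[of b] by (auto simp: subspace_def matrix_vector_right_distrib matrix_vector_mult_scaleR)
        (auto simp: U_def)
  next
    case (step x)
    then obtain g where "g \<in> G" "x = g *v b" by blast
    then show ?case
      using span_U[OF mult_G[OF that(1)]] by (simp add: matrix_vector_mul_assoc)
        (simp add: U_def)
  qed
  have plus: "\<rho> a \<in> span G" if "a \<in> R_plus p q" for a
    using image(2) that by blast
  have subrep: "plus_subrep p q \<rho> (U b)" for b
    using sub_U U_inv plus by (simp add: plus_subrep_def)
  have ip: "(g *v b) \<bullet> (h *v b) = (if g = h then 1 else 0)" if "b \<in> B" "g \<in> G" "h \<in> G" for b g h
    using that B(2) norm orth by simp
  have U_orth: "u \<bullet> v = 0" if "b \<in> B" "b' \<in> B" "b \<noteq> b'" "u \<in> U b" "v \<in> U b'" for b b' u v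
  proof -
    have 1: "(g *v b) \<bullet> v = 0" if g: "g \<in> G" for g
      using \<open>v \<in> U b'\<close> unfolding U_def
    proof (induction rule: span_induct)
      case (step x)
      then show ?case using B(3) that \<open>b \<in> B\<close> \<open>b' \<in> B\<close> \<open>b \<noteq> b'\<close> by blast
    qed (auto simp: subspace_def inner_add_right)
    show ?thesis
      using \<open>u \<in> U b\<close> unfolding U_def
    proof (induction rule: span_induct)
      case (step x)
      then show ?case using 1 by blast
    qed (auto simp: subspace_def inner_add_left)
  qed
  obtain b0 where b0: "b0 \<in> B"
  proof (cases "B = {}")
    case True
    then have "(UNIV :: (real^'m) set) = {0}" using B(4) by simp
    then have "(1 :: real^'m) = 0" by blast
    then show ?thesis by simp
  qed blast
  \<comment> \<open>The intertwiner taking \<open>g *v b\<close> to \<open>g *v b'\<close>: inner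
    products read off the coordinates in the orthonormal orbit of \<open>b\<close>.\<close>
  define f where "f b b' x = (\<Sum>g\<in>G. ((g *v b) \<bullet> x) *\<^sub>R (g *v b'))" for b b' x :: "real^'m"
  have f_lin: "linear (f b b')" for b b'
    by (rule linearI) (simp_all add: f_def inner_add_right scaleR_add_left sum.distrib scaleR_sum_right)
  have f_G: "f b b' (g *v b) = g *v b'" if "b \<in> B" "g \<in> G" for b b' g
  proof -
    have "f b b' (g *v b) = (\<Sum>h\<in>G. if h = g then h *v b' else 0)"
      unfolding f_def using that by (intro sum.cong refl) (simp add: ip)
    then show ?thesis using that G by simp
  qed
  have f_span: "f b b' (C *v b) = C *v b'" if "b \<in> B" "C \<in> span G" for b b' C
    using that(2)
  proof (induction rule: span_induct)
    case base
    show ?case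
      by (auto simp: subspace_def matrix_vector_mult_add_rdistrib matrix_vector_mult_scaleR_left
          linear_add[OF f_lin] linear_scale[OF f_lin] linear_0[OF f_lin])
  qed (rule f_G[OF that(1)])
  have U_C: "\<exists>C\<in>span G. u = C *v b" if "u \<in> U b" for u b
    using that unfolding U_def
  proof (induction rule: span_induct)
    case base
    show ?case
      unfolding subspace_def
      by (auto intro: bexI[of _ 0] span_0)
        (metis matrix_vector_mult_add_rdistrib span_add, metis matrix_vector_mult_scaleR_left span_scale)
  next
    case (step x)
    then show ?case by (auto intro: span_base)
  qed
  have equiv: "plus_equivalent p q \<rho> (U b0) (U b)" if b: "b \<in> B" for b
    unfolding plus_equivalent_def
  proof (intro exI conjI ballI)
    show "linear (f b0 b)" by (rule f_lin)
    show "bij_betw (f b0 b) (U b0) (U b)"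
      by (rule bij_betw_byWitness[where f' = "f b b0"])
        (auto dest!: U_C simp: f_span b0 b span_U)
    fix a u assume a: "a \<in> R_plus p q" and u: "u \<in> U b0"
    obtain C where C: "C \<in> span G" "u = C *v b0" using U_C[OF u] by blast
    have "\<rho> a ** C \<in> span G"
      using C(1)
    proof (induction rule: span_induct)
      case base
      show ?case by (auto simp: subspace_def mat_alg span_0 span_add span_scale)
    qed (rule mult_G[OF plus[OF a]])
    then show "f b0 b (\<rho> a *v u) = \<rho> a *v f b0 b u"
      using C b0 by (simp add: matrix_vector_mul_assoc f_span)
  qed
  have "plus_irreducible p q \<rho> (U b0)"
    unfolding plus_irreducible_def
  proof (intro conjI allI impI)
    show "plus_subrep p q \<rho> (U b0)" by (rule subrep)
    have "b0 \<in> U b0" using G_mem[OF G(2), of b0] by simp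
    moreover have "b0 \<noteq> 0" using b0 B(2) by auto
    ultimately show "U b0 \<noteq> {0}" by blast
    fix V assume V: "plus_subrep p q \<rho> V \<and> V \<subseteq> U b0"
    then have sub: "subspace V" and inv: "\<And>g u. g \<in> G \<Longrightarrow> u \<in> V \<Longrightarrow> g *v u \<in> V"
      using image(1) by (auto simp: plus_subrep_def)
    show "V = {0} \<or> V = U b0"
    proof (cases "V = {0}")
      case False
      then obtain u where u: "u \<in> V" "u \<noteq> 0" using subspace_0[OF sub] by blast
      define v where "v = (1 / norm u) *\<^sub>R u"
      have v: "v \<in> V" "v \<bullet> v = 1"
        using u sub by (simp_all add: v_def subspace_scale dot_square_norm power2_eq_square)
      \<comment> \<open>A nonzero invariant subspace contains the orbit of a unit vector, so by
        dimension it is all of \<open>U b0\<close>.\<close>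
      have card: "dim (U b) = card G" if b: "b \<bullet> b = 1" for b
      proof -
        have "dim ((\<lambda>(g, b). g *v b) ` (G \<times> {b})) = card G * card {b}"
          by (rule orthonormal_orbits_card[OF G(1) norm orth]) (use b in auto)
        moreover have "(\<lambda>(g, b). g *v b) ` (G \<times> {b}) = (\<lambda>g. g *v b) ` G" by auto
        ultimately show ?thesis by (simp add: U_def)
      qed
      have "U v \<subseteq> V"
        unfolding U_def using inv v sub by (intro span_minimal) auto
      then have "dim (U b0) \<le> dim V"
        using card v b0 B(2) dim_subset by (metis)
      then show ?thesis
        using subspace_dim_equal[OF sub sub_U] V by blast
    qed simp
  qed
  \<comment> \<open>Enumerates the blocks, since \<open>internal_direct_sum\<close> is indexed by
    natural numbers.\<close>
  moreover obtain h where h: "bij_betw h {..<card B} B"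
    using B(1) bij_betw_from_nat_into_finite[of B] by blast
  then have hB: "h i \<in> B" if "i < card B" for i
    using that by (auto simp: bij_betw_def)
  have "internal_direct_sum (card B) (\<lambda>i. U (h i))"
    unfolding internal_direct_sum_def
  proof (intro conjI allI impI; (elim conjE)?)
    fix w :: "real^'m"
    have "w \<in> span ((\<lambda>(g, b). g *v b) ` (G \<times> B))" using B(4) by simp
    then show "\<exists>u. (\<forall>i<card B. u i \<in> U (h i)) \<and> w = (\<Sum>i<card B. u i)"
    proof (induction rule: span_induct)
      case base
      show ?case
        unfolding subspace_def
      proof (intro conjI ballI allI; clarsimp?)
        show "\<exists>u. (\<forall>i<card B. u i \<in> U (h i)) \<and> sum u {..<card B} = 0"
          by (rule exI[of _ "\<lambda>_. 0"]) (simp add: subspace_0[OF sub_U])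
      next
        fix u v assume "\<forall>i<card B. u i \<in> U (h i)" "\<forall>i<card B. v i \<in> U (h i)"
        then show "\<exists>w. (\<forall>i<card B. w i \<in> U (h i)) \<and> sum u {..<card B} + sum v {..<card B} = sum w {..<card B}"
          by (intro exI[of _ "\<lambda>i. u i + v i"]) (simp add: subspace_add[OF sub_U] sum.distrib)
      next
        fix c and u assume "\<forall>i<card B. u i \<in> U (h i)"
        then show "\<exists>w. (\<forall>i<card B. w i \<in> U (h i)) \<and> c *\<^sub>R sum u {..<card B} = sum w {..<card B}"
          by (intro exI[of _ "\<lambda>i. c *\<^sub>R u i"]) (simp add: subspace_scale[OF sub_U] scaleR_sum_right)
      qed
    next
      case (step x)
      then obtain g b where gb: "g \<in> G" "b \<in> B" "x = g *v b" by auto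
      have "b \<in> h ` {..<card B}"
        unfolding bij_betw_imp_surj_on[OF h] by (fact gb(2))
      then obtain j where j: "j < card B" "h j = b" by blast
      show ?case
        using gb j G_mem subspace_0[OF sub_U]
        by (intro exI[of _ "\<lambda>i. if i = j then x else 0"]) (simp add: sum.delta)
    qed
  next
    fix u i assume u: "\<forall>i<card B. u i \<in> U (h i)" and sum: "(\<Sum>i<card B. u i) = 0" and i: "i < card B"
    \<comment> \<open>The blocks are orthogonal, so pairing the sum with \<open>u i\<close> leaves
      only \<open>u i \<bullet> u i\<close>.\<close>
    have "0 = (\<Sum>j<card B. u i \<bullet> u j)"
      using sum by (simp flip: inner_sum_right)
    also have "\<dots> = (\<Sum>j<card B. if j = i then u i \<bullet> u i else 0)"
    proof (intro sum.cong refl)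
      fix j assume "j \<in> {..<card B}"
      then show "u i \<bullet> u j = (if j = i then u i \<bullet> u i else 0)"
        using U_orth[of "h i" "h j" "u i" "u j"] u i hB h by (auto simp: bij_betw_def inj_on_def)
    qed
    finally show "u i = 0" using i by simp
  qed
  ultimately show ?thesis
    unfolding pure_def using subrep equiv hB by blast
qed

section \<open>The even subalgebra for two generators\<close>

lemma plus_image:
  assumes n: "p + q = 2" and J: "(S 1 ** S 2) ** (S 1 ** S 2) = c *\<^sub>R mat 1"
    and a: "a \<in> R_plus p q"
  shows "\<exists>\<alpha> \<beta>. \<rho> a = \<alpha> *\<^sub>R mat 1 + \<beta> *\<^sub>R (S 1 ** S 2)"
  using a
proof (induction rule: R_plus.induct)
  case one
  show ?case by (rule exI[of _ 1], rule exI[of _ 0]) (simp add: rep_one)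
next
  case (gen i j)
  then have "i = 1" "j = 2" using n by auto
  then show ?case
    using rep_mult[OF R_gen_carrier R_gen_carrier, of 1 2] n
    by (intro exI[of _ 0] exI[of _ 1]) simp
next
  case (add x y)
  then obtain \<alpha> \<beta> \<gamma> \<delta> where "\<rho> x = \<alpha> *\<^sub>R mat 1 + \<beta> *\<^sub>R (S 1 ** S 2)" "\<rho> y = \<gamma> *\<^sub>R mat 1 + \<delta> *\<^sub>R (S 1 ** S 2)"
    by blast
  then show ?case
    using rep_add[OF add(1,2)[THEN R_plus_carrier]]
    by (intro exI[of _ "\<alpha> + \<gamma>"] exI[of _ "\<beta> + \<delta>"]) (simp add: algebra_simps)
next
  case (scale x r)
  then obtain \<alpha> \<beta> where "\<rho> x = \<alpha> *\<^sub>R mat 1 + \<beta> *\<^sub>R (S 1 ** S 2)"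
    by blast
  then show ?case
    using rep_scale[OF scale(1)[THEN R_plus_carrier]]
    by (intro exI[of _ "r * \<alpha>"] exI[of _ "r * \<beta>"]) (simp add: algebra_simps)
next
  \<comment> \<open>The square of \<open>S 1 ** S 2\<close> is scalar, so products stay in the
    span.\<close>
  case (mult x y)
  then obtain \<alpha> \<beta> \<gamma> \<delta> where "\<rho> x = \<alpha> *\<^sub>R mat 1 + \<beta> *\<^sub>R (S 1 ** S 2)" "\<rho> y = \<gamma> *\<^sub>R mat 1 + \<delta> *\<^sub>R (S 1 ** S 2)"
    by blast
  then show ?case
    using rep_mult[OF mult(1,2)[THEN R_plus_carrier]] J
    by (intro exI[of _ "\<alpha> * \<gamma> + \<beta> * \<delta> * c"] exI[of _ "\<alpha> * \<delta> + \<beta> * \<gamma>"])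
      (simp add: mat_alg algebra_simps)
qed

lemma pair_in_image: "p + q = 2 \<Longrightarrow> S 1 ** S 2 \<in> \<rho> ` R_plus p q"
  using rep_mult[OF R_gen_carrier R_gen_carrier, of 1 2] R_plus.gen[of 1 2 p q]
  by (metis (no_types, lifting) atLeastAtMost_iff image_eqI one_le_numeral order_refl one_less_numeral_iff semiring_norm(76))

lemma one_in_image: "mat 1 \<in> \<rho> ` R_plus p q"
  unfolding rep_one[symmetric] by (rule imageI[OF R_plus.one])

text \<open>Both generators lie in one factor, so \<open>J\<close> is an orthogonal complex
  structure and the even subalgebra acts as the complex numbers.\<close>

lemma pure_definite:
  assumes "p + q = 2" "p \<noteq> 1"
  shows "pure p q \<rho>"
proof -
  define J where "J = S 1 ** S 2"
  have idx: "1 \<in> idx" "2 \<in> idx" using assms by auto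
  have "\<epsilon> 1 * \<epsilon> 2 = 1"
    using assms by (auto simp: sgn_pq_def)
  then have swp: "S 2 ** S 1 = - J"
    using swap[OF idx(2,1)] by (simp add: J_def mult.commute)
  have skew: "transpose J = - J"
    using idx swp by (simp add: J_def matrix_transpose_mul sym)
  have "J ** J = S 1 ** (S 2 ** S 1) ** S 2"
    by (simp add: J_def matrix_mul_assoc)
  also have "\<dots> = - (S 1 ** (S 1 ** S 2) ** S 2)"
    unfolding swp J_def by (simp add: mat_alg)
  also have "\<dots> = - mat 1"
    using idx by (simp add: square square_left flip: matrix_mul_assoc)
  finally have JJ: "J ** J = - mat 1" .
  have neq: "J \<noteq> mat 1"
    using JJ mat_one_neq_minus[where 'm='m] by auto
  have skew0: "x \<bullet> (J *v x) = 0" "(J *v x) \<bullet> x = 0" for x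
    using inner_mult_transpose[of J x x] unfolding skew matrix_vector_mult_minus_left
    by (simp_all add: inner_commute)
  have iso: "(J *v x) \<bullet> (J *v x) = x \<bullet> x" for x
    unfolding inner_mult_transpose[of J] skew
    by (simp add: matrix_vector_mul_assoc mat_minus_left JJ)
  show ?thesis
  proof (rule pure_orbits[of "{mat 1, J}"])
    fix g h assume gh: "g \<in> {mat 1, J}" "h \<in> {mat 1, J}"
    define c :: real where "c = (if g = J \<and> h = mat 1 then -1 else 1)"
    have "transpose g ** h = c *\<^sub>R (if g = h then mat 1 else J)"
      using gh by (auto simp: c_def skew mat_minus_left JJ neq neq[symmetric])
    moreover have "(if g = h then mat 1 else J) \<in> {mat 1, J}"
      by simp
    ultimately show "\<exists>k\<in>{mat 1, J}. \<exists>c. transpose g ** h = c *\<^sub>R k"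
      by blast
  next
    show "{mat 1, J} \<subseteq> \<rho> ` R_plus p q"
      using pair_in_image[OF assms(1)] one_in_image by (simp add: J_def)
    have "\<rho> a \<in> span {mat 1, J}" if a: "a \<in> R_plus p q" for a
    proof -
      obtain \<alpha> \<beta> where "\<rho> a = \<alpha> *\<^sub>R mat 1 + \<beta> *\<^sub>R J"
        using plus_image[OF assms(1) _ a, of "-1", folded J_def] JJ by (metis scaleR_minus1_left)
      then show ?thesis by (simp add: span_add span_scale span_base)
    qed
    then show "\<rho> ` R_plus p q \<subseteq> span {mat 1, J}" by blast
  qed (auto simp: iso skew0)
qed

text \<open>The even subalgebra acts by scalars, so all lines are irreducible and
  equivalent.\<close>

lemma pure_scalar:
  assumes "p + q = 2" "S 1 ** S 2 = c *\<^sub>R mat 1"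
  shows "pure p q \<rho>"
proof (rule pure_orbits[of "{mat 1}"])
  show "{mat 1} \<subseteq> \<rho> ` R_plus p q"
    using one_in_image by simp
next
  have "\<rho> a \<in> span {mat 1}" if a: "a \<in> R_plus p q" for a
  proof -
    have "(S 1 ** S 2) ** (S 1 ** S 2) = (c * c) *\<^sub>R mat 1"
      unfolding assms(2) by (simp add: mat_alg)
    from plus_image[OF assms(1) this a] show ?thesis
      unfolding assms(2) by (auto simp: span_add span_scale span_base)
  qed
  then show "\<rho> ` R_plus p q \<subseteq> span {mat 1}" by blast
qed (auto intro: exI[of _ 1])

end

section \<open>One generator in each factor\<close>

text \<open>\<open>E\<close> is the projection onto the support of \<open>Q\<close>, on which
  \<open>Q'\<close> vanishes. Contraction with \<open>Q\<close> gives a linear equation for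
  \<open>Z\<close>; compressing it by \<open>E\<close> shows that \<open>Z\<close> vanishes on that
  support, and what remains is a multiple of \<open>Q'\<close>.\<close>

lemma complementary_contraction:
  fixes Q Q' Z Z' E :: "real^'m^'m"
  assumes sym: "transpose Q = Q" "transpose Q' = Q'" "transpose Z = Z" "transpose Z' = Z'"
    and E: "Q ** Q = 4 *\<^sub>R E" "E ** E = E" "E ** Q = Q" "Q ** E = Q" "E ** Q' = 0" "Q' ** E = 0"
    and QQ': "Q ** Q' = 0" "Q' ** Q = 0"
    and pos: "trace E > 0"
    and zero: "\<And>w. qform Q w * qform Z w + qform Q' w * qform Z' w = 0"
  shows "Z = (- trace (Z' ** Q) / (4 * trace E)) *\<^sub>R Q'"
proof -
  define a s t where "a = trace E" and "s = trace (Z ** Q)" and "t = trace (Z' ** Q)"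
  have eq: "s *\<^sub>R Q + (4 * a) *\<^sub>R Z + 8 *\<^sub>R (E ** Z + Z ** E) + t *\<^sub>R Q' = 0"
  proof -
    have "(\<Sum>i\<in>UNIV. trace ((if i then Z else Z') ** Q) *\<^sub>R (if i then Q else Q') +
        trace ((if i then Q else Q') ** Q) *\<^sub>R (if i then Z else Z') +
        2 *\<^sub>R ((if i then Q else Q') ** Q ** (if i then Z else Z') + (if i then Z else Z') ** Q ** (if i then Q else Q'))) = 0"
      by (rule quartic_contraction[where S = "\<lambda>i. if i then Q else Q'" and Y = "\<lambda>i. if i then Z else Z'"])
        (auto simp: sym UNIV_bool zero add.commute)
    then show ?thesis
      by (simp add: UNIV_bool E QQ' trace_zero trace_scaleR mat_alg a_def s_def t_def matrix_mul_assoc[symmetric])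
         (simp add: matrix_mul_assoc E QQ' mat_alg algebra_simps)
  qed
  \<comment> \<open>Left multiplication by \<open>E\<close> removes \<open>Q'\<close>; right
    multiplication then leaves only \<open>Q\<close> and \<open>E ** Z ** E\<close>.\<close>
  have left: "s *\<^sub>R Q + (4 * a + 8) *\<^sub>R (E ** Z) + 8 *\<^sub>R (E ** Z ** E) = 0"
    using arg_cong[OF eq, of "\<lambda>U. E ** U"]
    by (simp add: mat_alg E matrix_mul_assoc scaleR_add_left scaleR_add_right add_ac)
  have both: "s *\<^sub>R Q + (4 * a + 16) *\<^sub>R (E ** Z ** E) = 0"
  proof -
    have "s *\<^sub>R Q + (4 * a + 8) *\<^sub>R (E ** Z ** E) + 8 *\<^sub>R (E ** Z ** E) = 0"
      using arg_cong[OF left, of "\<lambda>U. U ** E"]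
      by (simp add: mat_alg E matrix_mul_assoc[symmetric])
    then show ?thesis
      by (simp add: scaleR_add_left[symmetric] add.assoc del: scaleR_add_left)
  qed
  have "trace (E ** Z ** E ** Q) = s"
  proof -
    have "trace (E ** Z ** E ** Q) = trace (Z ** (Q ** E))"
      by (simp add: E flip: matrix_mul_assoc) (metis trace_mul_sym matrix_mul_assoc E(4))
    then show ?thesis by (simp add: E s_def)
  qed
  \<comment> \<open>The trace against \<open>Q\<close> recovers \<open>s\<close> from
    \<open>E ** Z ** E\<close>, and both coefficients of \<open>s\<close> are positive.\<close>
  then have "s * (4 * a) + (4 * a + 16) * s = 0"
    using arg_cong[OF both, of "\<lambda>U. trace (U ** Q)"]
    by (simp add: mat_alg trace_alg E a_def)
  then have "s * (8 * a + 16) = 0"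
    by (simp add: algebra_simps)
  then have s: "s = 0"
    using pos by (simp add: a_def)
  have "E ** Z ** E = 0"
    using both pos by (simp add: s a_def)
  with left have EZ: "E ** Z = 0"
    using pos by (simp add: s a_def)
  have tE: "transpose E = E"
  proof -
    have "4 *\<^sub>R transpose E = 4 *\<^sub>R E"
      unfolding transpose_scalar[symmetric] E(1)[symmetric] by (simp only: matrix_transpose_mul sym(1))
    then show ?thesis by (metis scaleR_cancel_left zero_neq_numeral)
  qed
  then have ZE: "Z ** E = 0"
    using arg_cong[OF EZ, of transpose] sym(3) by (simp add: matrix_transpose_mul transpose_zero)
  have "(4 * a) *\<^sub>R Z = (- t) *\<^sub>R Q'"
    using eq by (simp add: s EZ ZE add_eq_0_iff)
  then have "(1 / (4 * a)) *\<^sub>R ((4 * a) *\<^sub>R Z) = (1 / (4 * a)) *\<^sub>R ((- t) *\<^sub>R Q')"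
    by (rule arg_cong)
  then show ?thesis
    using pos by (simp add: a_def t_def)
qed

context representation
begin

text \<open>The quartic form is the product of the forms of \<open>S 1 + S 2\<close> and
  \<open>S 1 - S 2\<close>, which live on the two eigenspaces of \<open>D = S 1 ** S 2\<close>. Both
  eigenspaces are nonzero because a scalar \<open>D\<close> would make the representation
  pure.\<close>

lemma indefinite_pair:
  assumes pq: "p = 1" "q = 1" and nonpure: "\<not> pure p q \<rho>"
  shows "X \<in> g_set \<Longrightarrow> \<exists>A\<in>so_set. \<forall>k\<in>idx. act X k = (\<Sum>i\<in>idx. A k i *\<^sub>R S i)"
    and "(\<Sum>i\<in>idx. a i *\<^sub>R S i) = 0 \<Longrightarrow> k \<in> idx \<Longrightarrow> a k = 0"
proof -
  have idx: "idx = {1, 2}" using pq by auto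
  note One_nat_def [simp del]
  define D where "D = S 1 ** S 2"
  have eps: "\<epsilon> 1 = 1" "\<epsilon> 2 = -1" using pq by (simp_all add: sgn_pq_def)
  have D': "S 2 ** S 1 = D"
    using swap[of 2 1] eps unfolding idx by (simp add: D_def)
  have sq: "S 1 ** S 1 = mat 1" "S 2 ** S 2 = mat 1" and sy: "transpose (S 1) = S 1" "transpose (S 2) = S 2"
    using square sym unfolding idx by blast+
  have D_sym: "transpose D = D"
    using D' by (simp only: D_def matrix_transpose_mul sy)
  have DS: "D ** S 1 = S 2" "S 1 ** D = S 2" "D ** S 2 = S 1" "S 2 ** D = S 1"
  proof -
    show "S 1 ** D = S 2" "D ** S 2 = S 1"
      unfolding D_def matrix_mul_assoc sq matrix_mul_lid
      unfolding matrix_mul_assoc[symmetric] sq matrix_mul_rid by (rule refl)+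
    show "D ** S 1 = S 2" "S 2 ** D = S 1"
      unfolding D'[symmetric] matrix_mul_assoc sq matrix_mul_lid
      unfolding matrix_mul_assoc[symmetric] sq matrix_mul_rid by (rule refl)+
  qed
  have DD: "D ** D = mat 1"
    by (metis D_def DS(1) matrix_mul_assoc sq(2))
  have nonscalar: "D \<noteq> c *\<^sub>R mat 1" for c
    using pure_scalar[of c] nonpure pq by (auto simp: D_def)
  define E F where "E = (1/2) *\<^sub>R (mat 1 + D)" and "F = (1/2) *\<^sub>R (mat 1 - D)"
  have idem: "E ** E = E" "F ** F = F"
    by (simp_all add: E_def F_def mat_alg DD) (simp_all add: algebra_simps flip: scaleR_add_left)
  have sym_EF: "transpose E = E" "transpose F = F"
    by (simp_all add: E_def F_def transpose_alg D_sym)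
  have pos: "trace E > 0" "trace F > 0"
  proof -
    have "E \<noteq> 0" "F \<noteq> 0"
      using nonscalar[of "-1"] nonscalar[of 1] by (auto simp: E_def F_def add_eq_0_iff)
    then have "E \<bullet> E > 0" "F \<bullet> F > 0" by simp_all
    then show "trace E > 0" "trace F > 0"
      by (simp_all only: inner_mat sym_EF idem)
  qed
  define Q Q' where "Q = S 1 + S 2" and "Q' = S 1 - S 2"
  have QQ: "Q ** Q = 4 *\<^sub>R E" "Q' ** Q' = 4 *\<^sub>R F" "Q ** Q' = 0" "Q' ** Q = 0"
    unfolding Q_def Q'_def E_def F_def mat_alg sq D' D_def[symmetric]
    by (simp_all add: vec_eq_iff algebra_simps)
  have EQ: "E ** Q = Q" "Q ** E = Q" "E ** Q' = 0" "Q' ** E = 0"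
    "F ** Q' = Q'" "Q' ** F = Q'" "F ** Q = 0" "Q ** F = 0"
    unfolding Q_def Q'_def E_def F_def mat_alg DS
    by (simp_all add: vec_eq_iff algebra_simps)
  have sym_Q: "transpose Q = Q" "transpose Q' = Q'"
    by (simp_all only: Q_def Q'_def transpose_alg sy)
  show "a k = 0" if "(\<Sum>i\<in>idx. a i *\<^sub>R S i) = 0" "k \<in> idx"
  proof -
    have "a 1 *\<^sub>R S 1 + a 2 *\<^sub>R S 2 = 0"
      using that(1) unfolding idx by simp
    from arg_cong[OF this, of "\<lambda>U. S 1 ** U"]
    have *: "a 1 *\<^sub>R mat 1 + a 2 *\<^sub>R D = 0"
      by (simp add: mat_alg sq D_def)
    have a2: "a 2 = 0"
    proof (rule ccontr)
      assume "a 2 \<noteq> 0"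
      have "a 2 *\<^sub>R D = (- a 1) *\<^sub>R mat 1"
        using * by (simp add: add_eq_0_iff)
      then have "(1 / a 2) *\<^sub>R (a 2 *\<^sub>R D) = (1 / a 2) *\<^sub>R ((- a 1) *\<^sub>R mat 1)"
        by (rule arg_cong)
      then have "D = (- a 1 / a 2) *\<^sub>R mat 1"
        using \<open>a 2 \<noteq> 0\<close> by simp
      with nonscalar show False by blast
    qed
    have "a 1 *\<^sub>R (mat 1 :: real^'m^'m) = 0"
      using * unfolding a2 by (simp only: scaleR_zero_left add_0_right)
    then have "trace (a 1 *\<^sub>R (mat 1 :: real^'m^'m)) = 0"
      by (simp only: trace_zero)
    then have "a 1 = 0" by (simp add: trace_scaleR trace_I)
    with a2 that(2) show ?thesis unfolding idx by auto
  qed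
  assume X: "X \<in> g_set"
  define Z Z' where "Z = act X 1 + act X 2" and "Z' = act X 1 - act X 2"
  have sym_Z: "transpose Z = Z" "transpose Z' = Z'"
    using act_sym[of _ X] idx by (simp_all add: Z_def Z'_def transpose_alg)
  \<comment> \<open>Membership in \<open>g_set\<close>, rewritten by the product rule for the two
    factors.\<close>
  have zero: "qform Q w * qform Z' w + qform Q' w * qform Z w = 0" for w
  proof -
    have "qform (S 1) w * qform (act X 1) w - qform (S 2) w * qform (act X 2) w = 0"
      using X unfolding g_set_def idx by (simp add: eps)
    then show ?thesis
      by (simp add: Q_def Q'_def Z_def Z'_def qform_add qform_diff algebra_simps)
  qed
  define \<alpha> where "\<alpha> = trace (Z ** Q) / (4 * trace E)"
  have Z': "Z' = (- \<alpha>) *\<^sub>R Q'"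
    using complementary_contraction[OF sym_Q sym_Z(2,1) QQ(1) idem(1) EQ(1-4) QQ(3,4) pos(1) zero]
    by (simp add: \<alpha>_def)
  \<comment> \<open>This trace ensures that the second contraction, with the roles exchanged, yields
    the same constant \<open>\<alpha>\<close>.\<close>
  have "trace (Z' ** Q') = - \<alpha> * (4 * trace F)"
    by (simp add: Z' mat_alg trace_alg QQ)
  then have Z: "Z = \<alpha> *\<^sub>R Q"
    using complementary_contraction[OF sym_Q(2,1) sym_Z(1,2) QQ(2) idem(2) EQ(5-8) QQ(4,3) pos(2)] zero pos
    by (simp add: add.commute)
  have act: "act X 1 = \<alpha> *\<^sub>R S 2" "act X 2 = \<alpha> *\<^sub>R S 1"
  proof -
    have "act X 1 = (1/2) *\<^sub>R (Z + Z')" "act X 2 = (1/2) *\<^sub>R (Z - Z')"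
      by (simp_all add: Z_def Z'_def flip: scaleR_2)
    moreover have "Z + Z' = 2 *\<^sub>R (\<alpha> *\<^sub>R S 2)" "Z - Z' = 2 *\<^sub>R (\<alpha> *\<^sub>R S 1)"
      unfolding Z Z' Q_def Q'_def by (simp_all add: vec_eq_iff algebra_simps)
    ultimately show "act X 1 = \<alpha> *\<^sub>R S 2" "act X 2 = \<alpha> *\<^sub>R S 1" by simp_all
  qed
  \<comment> \<open>\<open>so(1,1)\<close> is spanned by the boost with equal off-diagonal
    entries.\<close>
  define A where "A i j = (if i \<in> idx \<and> j \<in> idx \<and> i \<noteq> j then \<alpha> else 0)" for i j
  have "A \<in> so_set"
    unfolding so_set_iff using eps by (auto simp: A_def idx)
  moreover have "\<forall>k\<in>idx. act X k = (\<Sum>i\<in>idx. A k i *\<^sub>R S i)"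
    unfolding idx by (simp add: A_def idx act)
  ultimately show "\<exists>A\<in>so_set. \<forall>k\<in>idx. act X k = (\<Sum>i\<in>idx. A k i *\<^sub>R S i)" by blast
qed

end

theorem theorem3p1:
  fixes p q :: nat and \<rho> :: "cliff2 \<Rightarrow> real^'m^'m"
  assumes "p + q \<ge> 1"
    and "R_representation p q \<rho>"
    and "symmetric_basis p q \<rho>"
    and "\<not> (p + q = 2 \<and> pure p q \<rho>)"
    and "\<not> (p + q = 3 \<and> CARD('m) \<in> {2, 4})"
    and "\<not> (p + q = 4 \<and> CARD('m) \<in> {4, 8})"
    and "\<not> (p + q = 5 \<and> CARD('m) = 8)"
    and "\<not> (p + q = 6 \<and> CARD('m) \<in> {8, 16})"
    and "\<not> (p + q = 7 \<and> CARD('m) = 16)"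
    and "\<not> (p + q = 8 \<and> CARD('m) = 16)"
    and "\<not> (p + q = 9 \<and> CARD('m) = 16)"
    and "\<not> (p + q = 10 \<and> CARD('m) \<in> {16, 32})"
    and "\<not> (p + q = 11 \<and> CARD('m) = 32)"
  shows "lie_isomorphic (g_lie p q \<rho>) (lie_direct_sum (so_lie p q) (h_lie p q \<rho>))"
proof -
  interpret representation p q \<rho>
    by unfold_locales (fact assms)+
  show ?thesis
    unfolding g_lie_eq h_lie_eq
  proof (cases "p + q = 2")
    case True
    then have "\<not> pure p q \<rho>" using assms(4) by blast
    \<comment> \<open>Two generators of the same factor always give a pure representation, so only
      \<open>p = q = 1\<close> remains.\<close>
    moreover from this have p: "p = 1"
      using pure_definite[OF True] by blast
    moreover from p True have "q = 1" by simp
    ultimately show "lie_isomorphic (matrix_lie g_set) (lie_direct_sum (so_lie p q) (matrix_lie h_set))"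
      by (intro lie_isomorphic_g indefinite_pair)
  next
    case False
    have "4 * (p + q) < CARD('m) + 8"
      by (rule card_large) (use False assms in simp_all)
    with False show "lie_isomorphic (matrix_lie g_set) (lie_direct_sum (so_lie p q) (matrix_lie h_set))"
      by (intro lie_isomorphic_g act_in_span trace_pair independent_gens) 
  qed
qed

end
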